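(* If $d\ge 2$, then $\mathrm{M}_d^{\mathbb{R}}$, the locus in $\mathrm{M}_d$ of equivalence classes of real rational maps of degree $d$, is connected.
   Context: $\mathrm{Rat}_d$ is the space of complex rational maps of degree $d\ge 2$, identified (via coefficients) with the complement in $\mathbb{P}^{2d+1}(\mathbb{C})$ of the resultant hypersurface, with the induced topology. $\mathrm{PSL}_2(\mathbb{C})$ acts on it by $\phi\mapsto T\circ\phi\circ T^{-1}$, and $\mathrm{M}_d=\mathrm{Rat}_d/\mathrm{PSL}_2(\mathbb{C})$ with the quotient topology; two maps in the same orbit are called equivalent. $\phi\in\mathrm{Rat}_d$ is a real rational map if it is equivalent to a rational map with real coefficients. *)

theory Defs
  imports "HOL-Analysis.Function_Topology" "Subresultants.Resultant_Prelim"
begin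

section \<open>Quotient topologies\<close>

definition quot_topology :: "'a topology \<Rightarrow> ('a \<Rightarrow> 'b) \<Rightarrow> 'b topology" where
  "quot_topology X f =
     topology (\<lambda>U. U \<subseteq> f ` topspace X \<and> openin X {x \<in> topspace X. f x \<in> U})"

lemma openin_quot_topology:
  "openin (quot_topology X f) U \<longleftrightarrow>
     U \<subseteq> f ` topspace X \<and> openin X {x \<in> topspace X. f x \<in> U}"
proof -
  define L where "L = (\<lambda>U. U \<subseteq> f ` topspace X \<and> openin X {x \<in> topspace X. f x \<in> U})"
  have Int: "L (S \<inter> T)" if "L S" "L T" for S T
  proof -
    have "{x \<in> topspace X. f x \<in> S \<inter> T} =
        {x \<in> topspace X. f x \<in> S} \<inter> {x \<in> topspace X. f x \<in> T}" by blast
    moreover have "openin X ({x \<in> topspace X. f x \<in> S} \<inter> {x \<in> topspace X. f x \<in> T})"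
      using that by (intro openin_Int) (simp_all add: L_def)
    ultimately show ?thesis
      using that(1) unfolding L_def by (simp add: le_infI1)
  qed
  have Union: "L (\<Union>K)" if "\<forall>S\<in>K. L S" for K
  proof -
    have "{x \<in> topspace X. f x \<in> \<Union>K} = (\<Union>S\<in>K. {x \<in> topspace X. f x \<in> S})" by blast
    moreover have "openin X (\<Union>S\<in>K. {x \<in> topspace X. f x \<in> S})"
      by (rule openin_Union) (use that in \<open>auto simp: L_def\<close>)
    moreover have "\<Union>K \<subseteq> f ` topspace X"
      using that unfolding L_def by blast
    ultimately show ?thesis
      unfolding L_def by simp
  qed
  have "istopology L"
    unfolding istopology_def using Int Union by blast
  then have "openin (topology L) U = L U"
    by (simp only: topology_inverse')
  then show ?thesis
    unfolding quot_topology_def L_def .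
qed

lemma topspace_quot_topology [simp]: "topspace (quot_topology X f) = f ` topspace X"
proof
  show "topspace (quot_topology X f) \<subseteq> f ` topspace X"
    using openin_quot_topology[of X f "topspace (quot_topology X f)"] by simp
  have "{x \<in> topspace X. f x \<in> f ` topspace X} = topspace X" by auto
  then have "openin (quot_topology X f) (f ` topspace X)"
    by (simp add: openin_quot_topology)
  then show "f ` topspace X \<subseteq> topspace (quot_topology X f)"
    by (rule openin_subset)
qed

lemma quotient_map_quot_topology: "quotient_map X (quot_topology X f) f"
  unfolding quotient_map_def by (simp add: openin_quot_topology)


section \<open>Complex projective space\<close>

text \<open>
  A vector of \<open>n + 1\<close> homogeneous coordinates is a function \<open>nat \<Rightarrow> complex\<close> vanishing at all
  indices above \<open>n\<close>; the product topology on such functions is the usual topology on the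
  vectors. A point of projective space is the set of all nonzero multiples of a nonzero vector.
\<close>

definition nonzero_vectors :: "nat \<Rightarrow> (nat \<Rightarrow> complex) set" where
  "nonzero_vectors n = {v. (\<forall>i>n. v i = 0) \<and> (\<exists>i\<le>n. v i \<noteq> 0)}"

definition proj_class :: "(nat \<Rightarrow> complex) \<Rightarrow> (nat \<Rightarrow> complex) set" where
  "proj_class v = {(\<lambda>i. c * v i) | c. c \<noteq> 0}"

definition proj_space :: "nat \<Rightarrow> (nat \<Rightarrow> complex) set topology" where
  "proj_space n = quot_topology (top_of_set (nonzero_vectors n)) proj_class"

text \<open>The Riemann sphere; \<open>[x 0 : x 1]\<close> corresponds to \<open>x 0 / x 1\<close>.\<close>

abbreviation sphere1 :: "(nat \<Rightarrow> complex) set set" where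
  "sphere1 \<equiv> topspace (proj_space 1)"

lemma topspace_proj_space: "topspace (proj_space n) = proj_class ` nonzero_vectors n"
  by (simp add: proj_space_def)

lemma proj_classI: "k \<noteq> 0 \<Longrightarrow> w = (\<lambda>i. k * v i) \<Longrightarrow> w \<in> proj_class v"
  unfolding proj_class_def by blast

lemma proj_classE:
  assumes "w \<in> proj_class v"
  obtains k where "k \<noteq> 0" "w = (\<lambda>i. k * v i)"
  using assms unfolding proj_class_def by blast

lemma proj_class_self: "v \<in> proj_class v"
  by (rule proj_classI[of 1]) simp_all

lemma proj_class_scale:
  assumes "c \<noteq> 0"
  shows "proj_class (\<lambda>i. c * v i) = proj_class v"
proof (intro equalityI subsetI)
  fix w assume "w \<in> proj_class (\<lambda>i. c * v i)"
  then obtain k where "k \<noteq> 0" "w = (\<lambda>i. k * (c * v i))"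
    by (rule proj_classE)
  with assms show "w \<in> proj_class v"
    by (intro proj_classI[of "k * c"]) (simp_all add: mult.assoc)
next
  fix w assume "w \<in> proj_class v"
  then obtain k where "k \<noteq> 0" "w = (\<lambda>i. k * v i)"
    by (rule proj_classE)
  with assms show "w \<in> proj_class (\<lambda>i. c * v i)"
    by (intro proj_classI[of "k / c"]) simp_all
qed


section \<open>Rational maps of degree \<open>d\<close>\<close>

text \<open>
  The vector \<open>v\<close> with indices \<open>0, \<dots>, 2 * d + 1\<close> encodes the rational map
  \<open>(v 0 + v 1 * z + \<dots> + v d * z ^ d) / (v (d + 1) + \<dots> + v (2 * d + 1) * z ^ d)\<close>.
\<close>

definition num_poly :: "nat \<Rightarrow> (nat \<Rightarrow> complex) \<Rightarrow> complex poly" where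
  "num_poly d v = (\<Sum>i\<le>d. monom (v i) i)"

definition den_poly :: "nat \<Rightarrow> (nat \<Rightarrow> complex) \<Rightarrow> complex poly" where
  "den_poly d v = (\<Sum>i\<le>d. monom (v (d + 1 + i)) i)"

text \<open>
  The resultant is the \<open>2 * d \<times> 2 * d\<close> Sylvester determinant, where numerator and denominator
  both have formal degree \<open>d\<close>. Hence it is homogeneous in \<open>v\<close>, and it also vanishes when both
  coefficients of \<open>z ^ d\<close> do.
\<close>

definition resultant_hypersurface :: "nat \<Rightarrow> (nat \<Rightarrow> complex) set set" where
  "resultant_hypersurface d =
     proj_class ` {v \<in> nonzero_vectors (2 * d + 1).
                     resultant_sub d d (num_poly d v) (den_poly d v) = 0}"

definition Rat_space :: "nat \<Rightarrow> (nat \<Rightarrow> complex) set topology" where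
  "Rat_space d = subtopology (proj_space (2 * d + 1)) (- resultant_hypersurface d)"

text \<open>The homogeneous form \<open>(F, G)\<close> of the rational map with coefficient vector \<open>v\<close>.\<close>

definition hom_eval :: "nat \<Rightarrow> (nat \<Rightarrow> complex) \<Rightarrow> (nat \<Rightarrow> complex) \<Rightarrow> nat \<Rightarrow> complex" where
  "hom_eval d v x =
     (\<lambda>_. 0)(0 := (\<Sum>i\<le>d. v i * x 0 ^ i * x 1 ^ (d - i)),
            1 := (\<Sum>i\<le>d. v (d + 1 + i) * x 0 ^ i * x 1 ^ (d - i)))"

text \<open>
  The unions below are over equal sets, since a change of representatives only rescales the
  value; see \<open>rat_map_class\<close> and \<open>moebius_P1_class\<close>.
\<close>

definition rat_map ::
  "nat \<Rightarrow> (nat \<Rightarrow> complex) set \<Rightarrow> (nat \<Rightarrow> complex) set \<Rightarrow> (nat \<Rightarrow> complex) set" where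
  "rat_map d \<phi> z = (\<Union>v\<in>\<phi>. \<Union>x\<in>z. proj_class (hom_eval d v x))"

lemma rat_map_class:
  "rat_map d (proj_class v) (proj_class x) = proj_class (hom_eval d v x)"
proof -
  have "hom_eval d (\<lambda>i. a * v i) (\<lambda>i. b * x i) = (\<lambda>i. (a * b ^ d) * hom_eval d v x i)" for a b
  proof -
    have "a * w * (b * x 0) ^ i * (b * x 1) ^ (d - i) = (a * b ^ d) * (w * x 0 ^ i * x 1 ^ (d - i))"
      if "i \<le> d" for i w
    proof -
      have "b ^ d = b ^ i * b ^ (d - i)"
        using that by (simp flip: power_add)
      then show ?thesis by (simp add: power_mult_distrib)
    qed
    then have "(\<Sum>i\<le>d. a * f i * (b * x 0) ^ i * (b * x 1) ^ (d - i)) =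
        (a * b ^ d) * (\<Sum>i\<le>d. f i * x 0 ^ i * x 1 ^ (d - i))" for f :: "nat \<Rightarrow> complex"
      unfolding sum_distrib_left by (intro sum.cong) simp_all
    from this[of v] this[of "\<lambda>i. v (d + 1 + i)"] show ?thesis
      by (intro ext) (simp add: hom_eval_def)
  qed
  then have "proj_class (hom_eval d v' x') = proj_class (hom_eval d v x)"
    if "v' \<in> proj_class v" "x' \<in> proj_class x" for v' x'
    using that by (elim proj_classE) (simp add: proj_class_scale)
  then show ?thesis
    unfolding rat_map_def using proj_class_self by blast
qed


section \<open>Conjugation by \<open>PSL\<^sub>2(\<complex>)\<close> and the moduli space\<close>

definition moebius_vec ::
  "complex \<Rightarrow> complex \<Rightarrow> complex \<Rightarrow> complex \<Rightarrow> (nat \<Rightarrow> complex) \<Rightarrow> nat \<Rightarrow> complex" where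
  "moebius_vec a b c e x = (\<lambda>_. 0)(0 := a * x 0 + b * x 1, 1 := c * x 0 + e * x 1)"

definition moebius_P1 ::
  "complex \<Rightarrow> complex \<Rightarrow> complex \<Rightarrow> complex \<Rightarrow> (nat \<Rightarrow> complex) set \<Rightarrow> (nat \<Rightarrow> complex) set" where
  "moebius_P1 a b c e z = (\<Union>x\<in>z. proj_class (moebius_vec a b c e x))"

lemma moebius_P1_class:
  "moebius_P1 a b c e (proj_class x) = proj_class (moebius_vec a b c e x)"
proof -
  have "moebius_vec a b c e (\<lambda>i. k * x i) = (\<lambda>i. k * moebius_vec a b c e x i)" for k
    by (auto simp: moebius_vec_def fun_eq_iff algebra_simps)
  then have "proj_class (moebius_vec a b c e x') = proj_class (moebius_vec a b c e x)"
    if "x' \<in> proj_class x" for x'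
    using that by (elim proj_classE) (simp add: proj_class_scale)
  then show ?thesis
    unfolding moebius_P1_def using proj_class_self by blast
qed

lemma moebius_P1_inverse:
  assumes "a * e - b * c = 1" "z \<in> sphere1"
  shows "moebius_P1 a b c e (moebius_P1 e (-b) (-c) a z) = z"
    and "moebius_P1 e (-b) (-c) a (moebius_P1 a b c e z) = z"
proof -
  obtain x where x: "\<And>i. i > 1 \<Longrightarrow> x i = 0" and z: "z = proj_class x"
    using assms(2) by (auto simp: topspace_proj_space nonzero_vectors_def)
  have *: "moebius_vec a b c e (moebius_vec e (-b) (-c) a x) = x"
    if "a * e - b * c = 1" for a b c e :: complex
  proof
    fix i
    have "a * (e * x 0 - b * x 1) + b * (a * x 1 - c * x 0) = (a * e - b * c) * x 0"
      "c * (e * x 0 - b * x 1) + e * (a * x 1 - c * x 0) = (a * e - b * c) * x 1"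
      by (simp_all add: algebra_simps)
    then show "moebius_vec a b c e (moebius_vec e (-b) (-c) a x) i = x i"
      using that x[of i] by (auto simp: moebius_vec_def)
  qed
  show "moebius_P1 a b c e (moebius_P1 e (-b) (-c) a z) = z"
    using *[OF assms(1)] by (simp add: z moebius_P1_class)
  show "moebius_P1 e (-b) (-c) a (moebius_P1 a b c e z) = z"
    using *[of e a "-b" "-c"] assms(1) by (simp add: z moebius_P1_class mult.commute)
qed

text \<open>
  \<open>\<psi> = T \<circ> \<phi> \<circ> T\<^sup>-\<^sup>1\<close> as self-maps of the sphere, with \<open>T\<close> represented by a matrix of determinant
  \<open>1\<close> with rows \<open>(a, b)\<close> and \<open>(c, e)\<close>, and \<open>T\<^sup>-\<^sup>1\<close> by the inverse matrix.
\<close>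

definition equivalent :: "nat \<Rightarrow> (nat \<Rightarrow> complex) set \<Rightarrow> (nat \<Rightarrow> complex) set \<Rightarrow> bool" where
  "equivalent d \<phi> \<psi> \<longleftrightarrow>
     (\<exists>a b c e. a * e - b * c = 1 \<and>
        (\<forall>z\<in>sphere1. rat_map d \<psi> z =
           moebius_P1 a b c e (rat_map d \<phi> (moebius_P1 e (-b) (-c) a z))))"

definition orbit :: "nat \<Rightarrow> (nat \<Rightarrow> complex) set \<Rightarrow> (nat \<Rightarrow> complex) set set" where
  "orbit d \<phi> = {\<psi> \<in> topspace (Rat_space d). equivalent d \<phi> \<psi>}"

definition moduli_space :: "nat \<Rightarrow> (nat \<Rightarrow> complex) set set topology" where
  "moduli_space d = quot_topology (Rat_space d) (orbit d)"

definition has_real_coeffs :: "(nat \<Rightarrow> complex) set \<Rightarrow> bool" where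
  "has_real_coeffs \<phi> \<longleftrightarrow> (\<exists>v\<in>\<phi>. \<forall>i. v i \<in> \<real>)"

definition real_rational_map :: "nat \<Rightarrow> (nat \<Rightarrow> complex) set \<Rightarrow> bool" where
  "real_rational_map d \<phi> \<longleftrightarrow>
     (\<exists>\<psi>\<in>topspace (Rat_space d). equivalent d \<phi> \<psi> \<and> has_real_coeffs \<psi>)"

definition real_locus :: "nat \<Rightarrow> (nat \<Rightarrow> complex) set set set" where
  "real_locus d = orbit d ` {\<phi> \<in> topspace (Rat_space d). real_rational_map d \<phi>}"

end

theory Submission
  imports Defs
    "HOL-Computational_Algebra.Fundamental_Theorem_Algebra"
    "HOL-Computational_Algebra.Field_as_Ring"
begin

text \<open>
  The real maps of degree \<open>d\<close> form a space with several components, distinguished by the topological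
  degree on the real projective line. They become connected in the moduli space because a map with
  extra symmetry can be real in two ways: its conjugate by \<open>x \<mapsto> k * x\<close> with a non-real \<open>k\<close> can again
  have real coefficients, and the two real maps define the same point although they can lie in
  different components.

  A left composition with a rotation makes infinity a fixed point of a real map
  (\<open>linked_to_fixes_infinity\<close>). The Euclidean algorithm then expands the map as a continued fraction.
  After a small perturbation of the denominators all partial quotients are linear, and their
  coefficients can be deformed to signs (\<open>deforms_to_cont_frac\<close>). So every real map is joined to
  some \<open>a\<^sub>1 * x + 1 / (a\<^sub>2 * x + 1 / \<dots>)\<close>, given by a word of \<open>d\<close> signs.

  It remains to join the words to each other. Two equal adjacent signs can be negated within the real
  maps (\<open>deforms_flip\<close>). The continued fractions are odd functions, so conjugation by \<open>x \<mapsto> \<i> * x\<close> acts on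
  the words; it negates every second sign (\<open>linked_alternate\<close>) and so exchanges equal and opposite
  neighbours. Hence any two adjacent signs can be negated (\<open>linked_flip_adjacent\<close>), and only the
  product of all signs remains (\<open>linked_to_last_sign\<close>). It is changed by one more symmetric family,
  the maps \<open>\<plusminus> x ^ d\<close> for odd \<open>d\<close> and \<open>x \<plusminus> 1 / x ^ (d - 1)\<close> for even \<open>d\<close>, conjugated by a root of \<open>- 1\<close>
  (\<open>linked_opposite_parity\<close>).
\<close>

section \<open>The resultant as a test for common roots\<close>

text \<open>
  Row by row, the Sylvester matrix lists the coefficients of \<open>x ^ (d - 1) * p, \<dots>, p\<close> and
  \<open>x ^ (d - 1) * q, \<dots>, q\<close>, highest power first. In this form a column vector of powers of \<open>z\<close>
  evaluates these polynomials at \<open>z\<close>, and a row vector forms a combination \<open>u * p + w * q\<close>.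
\<close>

lemma sylvester_mat_sub_square_index:
  fixes p q :: "'a :: comm_semiring_1 poly"
  assumes "degree p \<le> d" "degree q \<le> d" "i < 2 * d" "j < 2 * d"
  shows "sylvester_mat_sub d d p q $$ (i, j) =
    coeff (if i < d then monom 1 (d - 1 - i) * p else monom 1 (2 * d - 1 - i) * q) (2 * d - 1 - j)"
  using assms by (auto simp: sylvester_mat_sub_index coeff_monom_mult mult_2 intro!: coeff_eq_0)

lemma resultant_sub_eq_0_if_common_root:
  fixes p q :: "'a :: field poly"
  assumes "degree p \<le> d" "degree q \<le> d" "d > 0" "poly p z = 0" "poly q z = 0"
  shows "resultant_sub d d p q = 0"
proof -
  define S where "S = sylvester_mat_sub d d p q"
  define v where "v = Matrix.vec (2 * d) (\<lambda>j. z ^ (2 * d - 1 - j))"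
  have S: "S \<in> carrier_mat (2 * d) (2 * d)"
    using sylvester_mat_sub_carrier[of d d p q] by (simp add: S_def mult_2)
  have "v $ (2 * d - 1) = 1"
    using assms(3) by (simp add: v_def)
  then have "v \<noteq> 0\<^sub>v (2 * d)"
    using assms(3) by auto
  moreover have "S *\<^sub>v v = 0\<^sub>v (2 * d)"
  proof (rule eq_vecI)
    fix i assume "i < dim_vec (0\<^sub>v (2 * d))"
    then have i: "i < 2 * d" by simp
    define r where "r = (if i < d then monom 1 (d - 1 - i) * p else monom 1 (2 * d - 1 - i) * q)"
    have "degree r \<le> 2 * d - 1"
      unfolding r_def using i assms(1,2)
      by (auto intro!: order_trans[OF degree_mult_le] simp: degree_monom_eq)
    have "(S *\<^sub>v v) $ i = (\<Sum>j<2*d. coeff r (2 * d - 1 - j) * z ^ (2 * d - 1 - j))"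
      using i S assms(1,2)
      by (auto simp: scalar_prod_def v_def S_def r_def sylvester_mat_sub_square_index lessThan_atLeast0
          intro!: sum.cong)
    also have "\<dots> = (\<Sum>k<2*d. coeff r k * z ^ k)"
      using sum.nat_diff_reindex[of "\<lambda>k. coeff r k * z ^ k" "2 * d"] by simp
    also have "\<dots> = poly r z"
      unfolding poly_altdef using \<open>degree r \<le> 2 * d - 1\<close> assms(3)
      by (intro sum.mono_neutral_right) (auto simp: coeff_eq_0)
    also have "\<dots> = 0"
      by (simp add: r_def assms poly_monom)
    finally show "(S *\<^sub>v v) $ i = 0\<^sub>v (2 * d) $ i" using i by simp
  qed (use S in auto)
  ultimately show ?thesis
    unfolding resultant_sub_def S_def[symmetric] det_0_iff_vec_prod_zero_field[OF S]
    by (intro exI[of _ v]) (auto simp: v_def)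
qed

text \<open>
  In homogeneous terms this is a common root at infinity: the first column of the Sylvester
  matrix vanishes.
\<close>

lemma resultant_sub_eq_0_if_degrees_less:
  fixes p q :: "'a :: field poly"
  assumes "degree p \<le> d" "degree q \<le> d" "d > 0" "coeff p d = 0" "coeff q d = 0"
  shows "resultant_sub d d p q = 0"
proof -
  define S where "S = sylvester_mat_sub d d p q"
  have S: "S \<in> carrier_mat (2 * d) (2 * d)"
    using sylvester_mat_sub_carrier[of d d p q] by (simp add: S_def mult_2)
  have top: "coeff p (d + k) = 0" "coeff q (d + k) = 0" for k
    using assms by (cases k; auto intro!: coeff_eq_0)+
  have "S *\<^sub>v unit_vec (2 * d) 0 = 0\<^sub>v (2 * d)"
  proof (rule eq_vecI)
    fix i assume "i < dim_vec (0\<^sub>v (2 * d))"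
    then have i: "i < 2 * d" by simp
    have "(S *\<^sub>v unit_vec (2 * d) 0) $ i = S $$ (i, 0)"
      using i S assms(3) by simp
    also have "\<dots> = 0"
    proof (cases "i < d")
      case True
      then show ?thesis
        using i assms(1-3) top(1)[of i]
        by (simp add: S_def sylvester_mat_sub_square_index coeff_monom_mult mult_2)
    next
      case False
      then show ?thesis
        using i assms(1-3) top(2)[of "i - d"]
        by (simp add: S_def sylvester_mat_sub_square_index coeff_monom_mult mult_2)
    qed
    finally show "(S *\<^sub>v unit_vec (2 * d) 0) $ i = 0\<^sub>v (2 * d) $ i" using i by simp
  qed (use S in auto)
  moreover have "unit_vec (2 * d) 0 \<noteq> (0\<^sub>v (2 * d) :: 'a vec)"
    using assms(3) by (metis index_unit_vec(1) index_zero_vec(1) mult_pos_pos zero_less_numeral zero_neq_one)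
  ultimately show ?thesis
    unfolding resultant_sub_def S_def[symmetric] det_0_iff_vec_prod_zero_field[OF S]
    by (intro exI[of _ "unit_vec (2 * d) 0"]) auto
qed

text \<open>
  A vector in the left kernel of the Sylvester matrix is a pair of cofactors of degree below \<open>d\<close>.
\<close>

lemma resultant_sub_eq_0_imp_syzygy:
  fixes p q :: "'a :: field poly"
  assumes "degree p \<le> d" "degree q \<le> d" "d > 0" "resultant_sub d d p q = 0"
  obtains u w where "u * p + w * q = 0" "degree u < d" "degree w < d" "u \<noteq> 0 \<or> w \<noteq> 0"
proof -
  define S where "S = sylvester_mat_sub d d p q"
  have S: "S \<in> carrier_mat (2 * d) (2 * d)"
    using sylvester_mat_sub_carrier[of d d p q] by (simp add: S_def mult_2)
  then have T: "S\<^sup>T \<in> carrier_mat (2 * d) (2 * d)" by simp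
  have "det (S\<^sup>T) = 0"
    using assms(4) det_transpose[OF S] by (simp add: resultant_sub_def S_def)
  then obtain v where v: "v \<in> carrier_vec (2 * d)" "v \<noteq> 0\<^sub>v (2 * d)" "S\<^sup>T *\<^sub>v v = 0\<^sub>v (2 * d)"
    unfolding det_0_iff_vec_prod_zero_field[OF T] by blast
  define u where "u = (\<Sum>i<d. monom (v $ i) (d - 1 - i))"
  define w where "w = (\<Sum>i<d. monom (v $ (d + i)) (d - 1 - i))"
  have coeff_rev: "coeff (\<Sum>i<d. monom (f i) (d - 1 - i)) (d - 1 - k) = f k" if "k < d"
    for f :: "nat \<Rightarrow> 'a" and k
  proof -
    have "coeff (\<Sum>i<d. monom (f i) (d - 1 - i)) (d - 1 - k) = (\<Sum>i<d. if i = k then f i else 0)"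
      unfolding coeff_sum using that by (intro sum.cong) (auto simp: coeff_monom)
    then show ?thesis using that by simp
  qed
  have "degree u \<le> d - 1" "degree w \<le> d - 1"
    unfolding u_def w_def by (auto intro!: degree_sum_le order_trans[OF degree_monom_le])
  then have deg: "degree u < d" "degree w < d" using assms(3) by auto
  obtain i where "i < 2 * d" "v $ i \<noteq> 0"
    using v(1,2) by (metis eq_vecI carrier_vecD index_zero_vec)
  have "u \<noteq> 0 \<or> w \<noteq> 0"
  proof (cases "i < d")
    case True
    then show ?thesis using coeff_rev[of i "\<lambda>i. v $ i"] \<open>v $ i \<noteq> 0\<close> by (auto simp: u_def)
  next
    case False
    then have "i - d < d" using \<open>i < 2 * d\<close> by simp
    then show ?thesis using coeff_rev[of "i - d" "\<lambda>i. v $ (d + i)"] \<open>v $ i \<noteq> 0\<close> False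
      by (auto simp: w_def)
  qed
  moreover have "u * p + w * q = 0"
  proof (rule poly_eqI)
    fix n
    show "coeff (u * p + w * q) n = coeff 0 n"
    proof (cases "n < 2 * d")
      case False
      have "degree (u * p) < n" "degree (w * q) < n"
        using False deg assms(1,2)
        by (auto intro!: le_less_trans[OF degree_mult_le])
      then show ?thesis by (simp add: coeff_eq_0)
    next
      case True
      define j where "j = 2 * d - 1 - n"
      have j: "j < 2 * d" "2 * d - 1 - j = n" using True by (auto simp: j_def)
      have split: "(\<Sum>i<2*d. f i) = (\<Sum>i<d. f i) + (\<Sum>i<d. f (d + i))" for f :: "nat \<Rightarrow> 'a"
        by (simp add: mult_2 sum.nat_group lessThan_atLeast0 flip: sum.atLeastLessThan_concat[of 0 d "d + d"])
          (simp add: sum.shift_bounds_nat_ivl[of f 0 d d, simplified] add.commute)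
      have "0 = (S\<^sup>T *\<^sub>v v) $ j" using v(3) j by simp
      also have "\<dots> = (\<Sum>i<2*d. S $$ (i, j) * v $ i)"
        using S T v(1) j(1) by (auto simp: scalar_prod_def lessThan_atLeast0 intro!: sum.cong)
      also have "\<dots> = (\<Sum>i<d. S $$ (i, j) * v $ i) + (\<Sum>i<d. S $$ (d + i, j) * v $ (d + i))"
        by (rule split)
      also have "(\<Sum>i<d. S $$ (i, j) * v $ i) = coeff (u * p) n"
        unfolding u_def sum_distrib_right coeff_sum
        using assms(1,2) j
        by (intro sum.cong) (auto simp: S_def sylvester_mat_sub_square_index coeff_monom_mult)
      also have "(\<Sum>i<d. S $$ (d + i, j) * v $ (d + i)) = coeff (w * q) n"
        unfolding w_def sum_distrib_right coeff_sum
        using assms(1,2) j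
        by (intro sum.cong) (auto simp: S_def sylvester_mat_sub_square_index coeff_monom_mult mult_2)
      finally show ?thesis by simp
    qed
  qed
  ultimately show thesis using that deg by blast
qed

lemma no_common_root_imp_coprime:
  fixes p q :: "complex poly"
  assumes "\<And>z. poly p z \<noteq> 0 \<or> poly q z \<noteq> 0"
  shows "coprime p q"
proof (rule coprimeI)
  fix c assume c: "c dvd p" "c dvd q"
  have "poly c z \<noteq> 0" for z
    using assms[of z] c by (auto elim!: dvdE)
  then have "degree c = 0"
    using fundamental_theorem_of_algebra[of c] constant_degree[of c] by blast
  moreover have "c \<noteq> 0" using \<open>\<And>z. poly c z \<noteq> 0\<close> by auto
  ultimately show "is_unit c" by (simp add: is_unit_iff_degree)
qed

text \<open>
  For the converse direction, if \<open>p\<close> has degree \<open>d\<close> and is coprime to \<open>q\<close>, then it divides the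
  cofactor of \<open>q\<close> in any relation \<open>u * p + w * q = 0\<close>, which is impossible below degree \<open>d\<close>;
  and symmetrically if \<open>q\<close> has degree \<open>d\<close>.
\<close>

lemma resultant_sub_neq_0_iff:
  fixes p q :: "complex poly"
  assumes "degree p \<le> d" "degree q \<le> d" "d > 0"
  shows "resultant_sub d d p q \<noteq> 0 \<longleftrightarrow>
    (\<forall>z. poly p z \<noteq> 0 \<or> poly q z \<noteq> 0) \<and> (coeff p d \<noteq> 0 \<or> coeff q d \<noteq> 0)"
    (is "?L \<longleftrightarrow> ?R")
proof
  show ?R if ?L
    using that resultant_sub_eq_0_if_common_root[OF assms] resultant_sub_eq_0_if_degrees_less[OF assms]
    by blast
  have key: "w = 0" if "coprime a b" "u * a + w * b = 0" "degree w < degree a"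
    for a b u w :: "complex poly"
  proof -
    have "a dvd w * b" using that(2) by (metis add_eq_0_iff2 dvd_minus_iff dvd_triv_right)
    then have "a dvd w" using that(1) by (simp add: coprime_dvd_mult_left_iff)
    then show ?thesis using that(3) dvd_imp_degree_le[of a w] by (cases "w = 0") auto
  qed
  show ?L if r: ?R
  proof
    assume "resultant_sub d d p q = 0"
    then obtain u w where uw: "u * p + w * q = 0" "degree u < d" "degree w < d" "u \<noteq> 0 \<or> w \<noteq> 0"
      using resultant_sub_eq_0_imp_syzygy[OF assms] by blast
    have cop: "coprime p q" using r no_common_root_imp_coprime by blast
    show False
    proof (cases "coeff p d = 0")
      case False
      then have p: "degree p = d" "p \<noteq> 0" using assms(1) le_degree by (auto intro: antisym)
      have "w = 0" using key[OF cop uw(1)] uw(3) p by simp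
      then show False using uw(1,4) p by simp
    next
      case True
      then have "coeff q d \<noteq> 0" using r by blast
      then have q: "degree q = d" "q \<noteq> 0" using assms(2) le_degree by (auto intro: antisym)
      have "u = 0" using key[of q p w u] cop uw(1,2) q by (simp add: coprime_commute add.commute)
      then show False using uw(1,4) q by simp
    qed
  qed
qed

section \<open>Real maps as pairs of polynomials\<close>

definition coeff_vec :: "nat \<Rightarrow> complex poly \<times> complex poly \<Rightarrow> nat \<Rightarrow> complex" where
  "coeff_vec d f = (\<lambda>i. if i \<le> d then coeff (fst f) i else coeff (snd f) (i - (d + 1)))"

text \<open>
  The last two conditions say that the resultant with formal degree \<open>d\<close> does not vanish, so these
  pairs represent the maps with real coefficients in the space of rational maps of degree \<open>d\<close>.
\<close>

definition real_map :: "nat \<Rightarrow> complex poly \<times> complex poly \<Rightarrow> bool" where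
  "real_map d f \<longleftrightarrow>
     (\<forall>i. coeff (fst f) i \<in> \<real> \<and> coeff (snd f) i \<in> \<real>) \<and>
     degree (fst f) \<le> d \<and> degree (snd f) \<le> d \<and>
     (coeff (fst f) d \<noteq> 0 \<or> coeff (snd f) d \<noteq> 0) \<and>
     (\<forall>z. poly (fst f) z \<noteq> 0 \<or> poly (snd f) z \<noteq> 0)"

definition moduli_point :: "nat \<Rightarrow> complex poly \<times> complex poly \<Rightarrow> (nat \<Rightarrow> complex) set set" where
  "moduli_point d f = orbit d (proj_class (coeff_vec d f))"

lemma coeff_truncated_sum:
  "coeff (\<Sum>i\<le>d. monom (f i) i) k = (if k \<le> d then f k else (0 :: 'a :: comm_monoid_add))"
  by (simp add: coeff_sum coeff_monom if_distrib)

lemma poly_eq_truncated_sum: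
  assumes "degree p \<le> d"
  shows "(\<Sum>i\<le>d. monom (coeff p i) i) = p"
  using assms by (auto intro!: poly_eqI simp: coeff_truncated_sum coeff_eq_0)

lemma num_poly_coeff_vec: "degree (fst f) \<le> d \<Longrightarrow> num_poly d (coeff_vec d f) = fst f"
  by (simp add: num_poly_def coeff_vec_def poly_eq_truncated_sum)

lemma den_poly_coeff_vec: "degree (snd f) \<le> d \<Longrightarrow> den_poly d (coeff_vec d f) = snd f"
  by (simp add: den_poly_def coeff_vec_def poly_eq_truncated_sum)

lemma coeff_vec_num_den:
  assumes "v \<in> nonzero_vectors (2 * d + 1)"
  shows "coeff_vec d (num_poly d v, den_poly d v) = v"
  using assms
  by (auto simp: coeff_vec_def num_poly_def den_poly_def coeff_truncated_sum nonzero_vectors_def fun_eq_iff)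

lemma degree_num_den: "degree (num_poly d v) \<le> d" "degree (den_poly d v) \<le> d"
  by (auto simp: num_poly_def den_poly_def coeff_truncated_sum intro!: degree_le)

lemma coeff_vec_in_nonzero_vectors:
  assumes "real_map d f"
  shows "coeff_vec d f \<in> nonzero_vectors (2 * d + 1)"
proof -
  have "coeff (snd f) (i - (d + 1)) = 0" if "i > 2 * d + 1" for i
    using assms that by (intro coeff_eq_0) (auto simp: real_map_def)
  moreover have "coeff_vec d f d \<noteq> 0 \<or> coeff_vec d f (2 * d + 1) \<noteq> 0"
    using assms by (auto simp: coeff_vec_def real_map_def)
  then have "\<exists>i\<le>2 * d + 1. coeff_vec d f i \<noteq> 0"
    by (metis le_add1 mult_2 order_refl trans_le_add1)
  ultimately show ?thesis
    by (auto simp: nonzero_vectors_def coeff_vec_def)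
qed

lemma num_poly_scale: "num_poly d (\<lambda>i. c * v i) = smult c (num_poly d v)"
  by (rule poly_eqI) (simp add: num_poly_def coeff_truncated_sum)

lemma den_poly_scale: "den_poly d (\<lambda>i. c * v i) = smult c (den_poly d v)"
  by (rule poly_eqI) (simp add: den_poly_def coeff_truncated_sum)

lemma resultant_scale_neq_0_iff:
  assumes "c \<noteq> 0" "d > 0"
  shows "resultant_sub d d (num_poly d (\<lambda>i. c * v i)) (den_poly d (\<lambda>i. c * v i)) \<noteq> 0 \<longleftrightarrow>
         resultant_sub d d (num_poly d v) (den_poly d v) \<noteq> 0"
proof -
  have deg: "degree (num_poly d w) \<le> d" "degree (den_poly d w) \<le> d" for w
    by (fact degree_num_den)+
  show ?thesis
    unfolding resultant_sub_neq_0_iff[OF deg assms(2)]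
    using assms(1) by (simp add: num_poly_scale den_poly_scale)
qed

lemma proj_class_in_Rat_space_iff:
  assumes "v \<in> nonzero_vectors (2 * d + 1)" "d > 0"
  shows "proj_class v \<in> topspace (Rat_space d) \<longleftrightarrow>
    resultant_sub d d (num_poly d v) (den_poly d v) \<noteq> 0"
proof -
  have "resultant_sub d d (num_poly d v) (den_poly d v) = 0"
    if "w \<in> nonzero_vectors (2 * d + 1)" "resultant_sub d d (num_poly d w) (den_poly d w) = 0"
      "proj_class v = proj_class w" for w
  proof -
    have "w \<in> proj_class v" using that(3) proj_class_self by simp
    then obtain k where k: "k \<noteq> 0" "w = (\<lambda>i. k * v i)" by (rule proj_classE)
    then show ?thesis
      using that(2) resultant_scale_neq_0_iff[of k d v] assms(2) by blast
  qed
  then show ?thesis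
    using assms(1)
    by (auto simp: Rat_space_def topspace_subtopology topspace_proj_space resultant_hypersurface_def)
qed

lemma real_map_in_Rat_space:
  assumes "real_map d f" "d > 0"
  shows "proj_class (coeff_vec d f) \<in> topspace (Rat_space d)"
proof -
  have deg: "degree (fst f) \<le> d" "degree (snd f) \<le> d"
    using assms(1) by (auto simp: real_map_def)
  show ?thesis
    unfolding proj_class_in_Rat_space_iff[OF coeff_vec_in_nonzero_vectors[OF assms(1)] assms(2)]
      num_poly_coeff_vec[OF deg(1)] den_poly_coeff_vec[OF deg(2)]
      resultant_sub_neq_0_iff[OF deg assms(2)]
    using assms(1) by (auto simp: real_map_def)
qed

section \<open>Equivalence classes of rational maps\<close>

lemma equivalent_refl:
  assumes "\<phi> \<in> topspace (Rat_space d)"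
  shows "equivalent d \<phi> \<phi>"
proof -
  obtain v where v: "\<phi> = proj_class v"
    using assms by (auto simp: Rat_space_def topspace_proj_space)
  have id: "moebius_vec 1 0 0 1 x = x" if "\<And>i. i > 1 \<Longrightarrow> x i = 0" for x
    using that by (auto simp: moebius_vec_def fun_eq_iff not_less_eq)
  have "rat_map d \<phi> z = moebius_P1 1 0 0 1 (rat_map d \<phi> (moebius_P1 1 (- 0) (- 0) 1 z))"
    if "z \<in> sphere1" for z
  proof -
    obtain x where x: "\<And>i. i > 1 \<Longrightarrow> x i = 0" "z = proj_class x"
      using \<open>z \<in> sphere1\<close> by (auto simp: topspace_proj_space nonzero_vectors_def)
    show ?thesis
      unfolding x(2) v by (simp add: moebius_P1_class rat_map_class id x(1)) (simp add: id hom_eval_def)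
  qed
  then show ?thesis
    unfolding equivalent_def by (intro exI[of _ 1] exI[of _ 0]) auto
qed

lemma moebius_vec_compose:
  "moebius_vec a b c e (moebius_vec a' b' c' e' x) =
   moebius_vec (a * a' + b * c') (a * b' + b * e') (c * a' + e * c') (c * b' + e * e') x"
  by (auto simp: moebius_vec_def fun_eq_iff algebra_simps)

lemma moebius_P1_compose:
  "moebius_P1 a b c e (moebius_P1 a' b' c' e' (proj_class x)) =
   moebius_P1 (a * a' + b * c') (a * b' + b * e') (c * a' + e * c') (c * b' + e * e') (proj_class x)"
  by (simp add: moebius_P1_class moebius_vec_compose)

lemma moebius_P1_in_sphere1:
  assumes "a * e - b * c = 1" "z \<in> sphere1"
  shows "moebius_P1 a b c e z \<in> sphere1"
proof -
  obtain x where x: "z = proj_class x" "\<And>i. i > 1 \<Longrightarrow> x i = 0" "\<exists>i\<le>1. x i \<noteq> 0"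
    using assms(2) by (auto simp: topspace_proj_space nonzero_vectors_def)
  have "\<exists>i\<le>1. moebius_vec a b c e x i \<noteq> 0"
  proof (rule ccontr)
    assume "\<not> ?thesis"
    then have "moebius_vec a b c e x 0 = 0" "moebius_vec a b c e x 1 = 0" by auto
    then have *: "a * x 0 + b * x 1 = 0" "c * x 0 + e * x 1 = 0" by (auto simp: moebius_vec_def)
    have "(a * e - b * c) * x 0 = e * (a * x 0 + b * x 1) - b * (c * x 0 + e * x 1)"
      "(a * e - b * c) * x 1 = a * (c * x 0 + e * x 1) - c * (a * x 0 + b * x 1)"
      by (auto simp: algebra_simps)
    then have "x 0 = 0" "x 1 = 0" using assms(1) * by auto
    then show False using x(3) by (auto simp: le_Suc_eq)
  qed
  then have "moebius_vec a b c e x \<in> nonzero_vectors 1"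
    by (auto simp: nonzero_vectors_def moebius_vec_def)
  then show ?thesis unfolding x(1) moebius_P1_class topspace_proj_space by blast
qed

lemma equivalent_sym:
  assumes "\<phi> \<in> topspace (Rat_space d)" "equivalent d \<phi> \<psi>"
  shows "equivalent d \<psi> \<phi>"
proof -
  obtain v where v: "\<phi> = proj_class v"
    using assms(1) by (auto simp: Rat_space_def topspace_proj_space)
  obtain a b c e where det: "a * e - b * c = 1"
    and eq: "\<And>z. z \<in> sphere1 \<Longrightarrow>
       rat_map d \<psi> z = moebius_P1 a b c e (rat_map d \<phi> (moebius_P1 e (-b) (-c) a z))"
    using assms(2) unfolding equivalent_def by blast
  have "rat_map d \<phi> z = moebius_P1 e (-b) (-c) a (rat_map d \<psi> (moebius_P1 a b c e z))"
    if z: "z \<in> sphere1" for z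
  proof -
    obtain x where x: "z = proj_class x"
      using z by (auto simp: topspace_proj_space)
    have det': "a * e - b * c = 1" "e * a - b * c = 1" using det by (auto simp: mult.commute)
    have "moebius_P1 e (-b) (-c) a (rat_map d \<psi> (moebius_P1 a b c e z)) =
        moebius_P1 e (-b) (-c) a (moebius_P1 a b c e (rat_map d \<phi> z))"
      using eq[OF moebius_P1_in_sphere1[OF det z]] moebius_P1_inverse(2)[OF det z] by simp
    also have "\<dots> = proj_class (moebius_vec 1 0 0 1 (hom_eval d v x))"
      unfolding x v rat_map_class moebius_P1_class moebius_vec_compose
      using det' by (simp add: algebra_simps)
    also have "moebius_vec 1 0 0 1 (hom_eval d v x) = hom_eval d v x"
      by (auto simp: moebius_vec_def hom_eval_def fun_eq_iff)
    finally show ?thesis unfolding x v rat_map_class by simp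
  qed
  then show ?thesis
    unfolding equivalent_def using det
    by (intro exI[of _ e] exI[of _ "-b"] exI[of _ "-c"] exI[of _ a]) (simp add: algebra_simps)
qed

lemma equivalent_trans:
  assumes "\<phi> \<in> topspace (Rat_space d)" "equivalent d \<phi> \<psi>" "equivalent d \<psi> \<chi>"
  shows "equivalent d \<phi> \<chi>"
proof -
  obtain v where v: "\<phi> = proj_class v"
    using assms(1) by (auto simp: Rat_space_def topspace_proj_space)
  obtain a b c e where det: "a * e - b * c = 1"
    and eq: "\<And>z. z \<in> sphere1 \<Longrightarrow>
       rat_map d \<psi> z = moebius_P1 a b c e (rat_map d \<phi> (moebius_P1 e (-b) (-c) a z))"
    using assms(2) unfolding equivalent_def by blast
  obtain a' b' c' e' where det': "a' * e' - b' * c' = 1"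
    and eq': "\<And>z. z \<in> sphere1 \<Longrightarrow>
       rat_map d \<chi> z = moebius_P1 a' b' c' e' (rat_map d \<psi> (moebius_P1 e' (-b') (-c') a' z))"
    using assms(3) unfolding equivalent_def by blast
  define A B C E where "A = a' * a + b' * c" "B = a' * b + b' * e" "C = c' * a + e' * c" "E = c' * b + e' * e"
  have "A * E - B * C = (a * e - b * c) * (a' * e' - b' * c')"
    unfolding A_B_C_E_def by (simp add: algebra_simps)
  then have "A * E - B * C = 1" using det det' by simp
  moreover have "rat_map d \<chi> z = moebius_P1 A B C E (rat_map d \<phi> (moebius_P1 E (-B) (-C) A z))"
    if z: "z \<in> sphere1" for z
  proof -
    obtain x where x: "z = proj_class x"
      using z by (auto simp: topspace_proj_space)
    have "moebius_P1 e' (-b') (-c') a' z \<in> sphere1"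
      using moebius_P1_in_sphere1[OF _ z, of e' a' "-b'" "-c'"] det' by (simp add: mult.commute)
    then have "rat_map d \<chi> z = moebius_P1 a' b' c' e' (moebius_P1 a b c e
        (rat_map d \<phi> (moebius_P1 e (-b) (-c) a (moebius_P1 e' (-b') (-c') a' z))))"
      using eq'[OF z] eq by simp
    also have "moebius_P1 e (-b) (-c) a (moebius_P1 e' (-b') (-c') a' z) = moebius_P1 E (-B) (-C) A z"
      unfolding x moebius_P1_compose A_B_C_E_def by (simp add: algebra_simps)
    finally show ?thesis
      unfolding x v moebius_P1_class rat_map_class moebius_vec_compose A_B_C_E_def .
  qed
  ultimately show ?thesis
    unfolding equivalent_def by blast
qed

lemma orbit_eq_if_equivalent:
  assumes "\<phi> \<in> topspace (Rat_space d)" "\<psi> \<in> topspace (Rat_space d)" "equivalent d \<phi> \<psi>"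
  shows "orbit d \<phi> = orbit d \<psi>"
  using assms equivalent_trans equivalent_sym unfolding orbit_def by blast

lemma moduli_point_in_real_locus:
  assumes "real_map d f" "d > 0"
  shows "moduli_point d f \<in> real_locus d"
proof -
  have "has_real_coeffs (proj_class (coeff_vec d f))"
    using assms(1) proj_class_self[of "coeff_vec d f"] unfolding has_real_coeffs_def
    by (intro bexI[of _ "coeff_vec d f"]) (auto simp: coeff_vec_def real_map_def)
  then show ?thesis
    using real_map_in_Rat_space[OF assms] equivalent_refl
    unfolding real_locus_def moduli_point_def real_rational_map_def by blast
qed

lemma real_locus_eq_moduli_points:
  assumes "d > 0"
  shows "real_locus d = moduli_point d ` {f. real_map d f}"
proof (intro equalityI subsetI)
  fix p assume "p \<in> real_locus d"
  then obtain \<phi> \<psi> where p: "p = orbit d \<phi>" and \<phi>: "\<phi> \<in> topspace (Rat_space d)"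
    and \<psi>: "\<psi> \<in> topspace (Rat_space d)" "equivalent d \<phi> \<psi>" "has_real_coeffs \<psi>"
    unfolding real_locus_def real_rational_map_def by blast
  obtain w where w: "\<psi> = proj_class w" "w \<in> nonzero_vectors (2 * d + 1)"
    using \<psi>(1) by (auto simp: Rat_space_def topspace_proj_space)
  obtain v where v: "v \<in> \<psi>" "\<forall>i. v i \<in> \<real>"
    using \<psi>(3) unfolding has_real_coeffs_def by blast
  then obtain k where k: "k \<noteq> 0" "v = (\<lambda>i. k * w i)"
    using w by (auto elim: proj_classE)
  then have v': "v \<in> nonzero_vectors (2 * d + 1)" "\<psi> = proj_class v"
    using w by (auto simp: nonzero_vectors_def proj_class_scale)
  define f where "f = (num_poly d v, den_poly d v)"
  have vec: "coeff_vec d f = v" using v' by (simp add: f_def coeff_vec_num_den)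
  have "resultant_sub d d (fst f) (snd f) \<noteq> 0"
    using \<psi>(1) v' assms by (simp add: f_def proj_class_in_Rat_space_iff)
  then have "real_map d f"
    using v(2) assms degree_num_den[of d v] unfolding real_map_def f_def
    by (subst (asm) resultant_sub_neq_0_iff) (auto simp: num_poly_def den_poly_def coeff_truncated_sum)
  moreover have "p = moduli_point d f"
    unfolding p moduli_point_def vec
    using orbit_eq_if_equivalent[OF \<phi> \<psi>(1,2)] v'(2) by simp
  ultimately show "p \<in> moduli_point d ` {f. real_map d f}" by blast
qed (use assms moduli_point_in_real_locus in auto)

section \<open>Connections inside the real locus\<close>

text \<open>
  Real maps whose classes lie in the same connected component of the real locus. Working with
  this relation avoids paths in the moduli space itself.
\<close>

definition linked :: "nat \<Rightarrow> complex poly \<times> complex poly \<Rightarrow> complex poly \<times> complex poly \<Rightarrow> bool" where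
  "linked d f g \<longleftrightarrow> (\<exists>T. connectedin (moduli_space d) T \<and> T \<subseteq> real_locus d \<and>
     moduli_point d f \<in> T \<and> moduli_point d g \<in> T)"

lemma linked_sym: "linked d f g \<Longrightarrow> linked d g f"
  unfolding linked_def by blast

lemma linked_trans: "linked d f g \<Longrightarrow> linked d g h \<Longrightarrow> linked d f h"
  unfolding linked_def
proof (elim exE conjE)
  fix S T
  assume "connectedin (moduli_space d) S" "connectedin (moduli_space d) T"
    "moduli_point d g \<in> S" "moduli_point d g \<in> T"
    and *: "S \<subseteq> real_locus d" "T \<subseteq> real_locus d" "moduli_point d f \<in> S" "moduli_point d h \<in> T"
  then have "connectedin (moduli_space d) (S \<union> T)"
    by (intro connectedin_Un) auto
  then show "\<exists>T. connectedin (moduli_space d) T \<and> T \<subseteq> real_locus d \<and>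
      moduli_point d f \<in> T \<and> moduli_point d h \<in> T"
    using * by (intro exI[of _ "S \<union> T"]) auto
qed

text \<open>
  The coefficient vector depends continuously on the parameter, and the passage from vectors to
  projective classes and from these to orbits is by quotient maps.
\<close>

lemma linked_path:
  fixes f :: "real \<Rightarrow> complex poly \<times> complex poly"
  assumes "d > 0" "connected S" "a \<in> S" "b \<in> S"
    and cont: "\<And>i. continuous_on S (\<lambda>t. coeff (fst (f t)) i)"
      "\<And>i. continuous_on S (\<lambda>t. coeff (snd (f t)) i)"
    and real: "\<And>t. t \<in> S \<Longrightarrow> real_map d (f t)"
  shows "linked d (f a) (f b)"
proof -
  have "continuous_on S (\<lambda>t. coeff_vec d (f t))"
  proof (rule continuous_on_coordinatewise_then_product)
    show "continuous_on S (\<lambda>t. coeff_vec d (f t) i)" for i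
      by (cases "i \<le> d") (simp_all add: coeff_vec_def cont)
  qed
  then have "continuous_map (top_of_set S) (top_of_set (nonzero_vectors (2 * d + 1))) (\<lambda>t. coeff_vec d (f t))"
    using coeff_vec_in_nonzero_vectors[OF real] by (auto simp: continuous_map_subtopology_eu)
  then have "continuous_map (top_of_set S) (proj_space (2 * d + 1)) (proj_class \<circ> (\<lambda>t. coeff_vec d (f t)))"
    unfolding proj_space_def
    by (rule continuous_map_compose) (rule quotient_imp_continuous_map[OF quotient_map_quot_topology])
  then have "continuous_map (top_of_set S) (Rat_space d) (proj_class \<circ> (\<lambda>t. coeff_vec d (f t)))"
    using real_map_in_Rat_space[OF real assms(1)]
    unfolding Rat_space_def by (intro continuous_map_into_subtopology) auto
  then have "continuous_map (top_of_set S) (moduli_space d) (orbit d \<circ> (proj_class \<circ> (\<lambda>t. coeff_vec d (f t))))"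
    unfolding moduli_space_def
    by (rule continuous_map_compose) (rule quotient_imp_continuous_map[OF quotient_map_quot_topology])
  moreover have "orbit d \<circ> (proj_class \<circ> (\<lambda>t. coeff_vec d (f t))) = (\<lambda>t. moduli_point d (f t))"
    by (simp add: moduli_point_def fun_eq_iff)
  ultimately have "connectedin (moduli_space d) ((\<lambda>t. moduli_point d (f t)) ` S)"
    using assms(2) connectedin_continuous_map_image[of "top_of_set S" "moduli_space d" _ S]
    by (simp add: connectedin_subtopology)
  then show ?thesis
    unfolding linked_def using assms(3,4) moduli_point_in_real_locus[OF real assms(1)]
    by (intro exI[of _ "(\<lambda>t. moduli_point d (f t)) ` S"]) auto
qed

lemma linked_refl: "real_map d f \<Longrightarrow> d > 0 \<Longrightarrow> linked d f f"
  using linked_path[of d "{0}" 0 0 "\<lambda>_. f"] by simp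

text \<open>
  The coefficients of \<open>g\<close> are, up to the common factor \<open>c\<close>, those of \<open>k * f (x / k)\<close>, the conjugate
  of \<open>f\<close> by \<open>x \<mapsto> k * x\<close>. Since \<open>k\<close> is an arbitrary nonzero complex number, two real maps that
  are not conjugate over the reals can be identified in this way, even if they lie in different
  components of the space of real maps.
\<close>

lemma linked_if_scaling_conjugate:
  assumes "real_map d f" "real_map d g" "d > 0" "k \<noteq> 0" "c \<noteq> 0"
    and fst: "\<And>i. i \<le> d \<Longrightarrow> coeff (fst g) i = c * k * coeff (fst f) i / k ^ i"
    and snd: "\<And>i. i \<le> d \<Longrightarrow> coeff (snd g) i = c * coeff (snd f) i / k ^ i"
  shows "linked d f g"
proof -
  \<comment> \<open>The matrix with diagonal \<open>\<mu>, 1 / \<mu>\<close> represents \<open>x \<mapsto> k * x\<close> with determinant \<open>1\<close>.\<close>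
  define \<mu> where "\<mu> = csqrt k"
  have \<mu>: "\<mu> ^ 2 = k" "\<mu> \<noteq> 0" using assms(4) by (auto simp: \<mu>_def)
  define v where "v = coeff_vec d f"
  define w where "w = coeff_vec d g"
  have w: "w i = c * k * v i / k ^ i" "w (d + 1 + i) = c * v (d + 1 + i) / k ^ i" if "i \<le> d" for i
    using that fst snd by (auto simp: v_def w_def coeff_vec_def)
  have pow: "(x0 / \<mu>) ^ i * (\<mu> * x1) ^ (d - i) = \<mu> ^ d * (x0 ^ i * x1 ^ (d - i) / k ^ i)"
    if "i \<le> d" for x0 x1 i
  proof -
    have "\<mu> ^ d = \<mu> ^ i * \<mu> ^ (d - i)" using that by (simp flip: power_add)
    moreover have "k ^ i = \<mu> ^ i * \<mu> ^ i" by (simp add: \<mu>(1)[symmetric] power2_eq_square power_mult_distrib)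
    ultimately show ?thesis using \<mu>(2) by (simp add: field_simps)
  qed
  have "rat_map d (proj_class w) (proj_class x) = moebius_P1 \<mu> 0 0 (1 / \<mu>)
      (rat_map d (proj_class v) (moebius_P1 (1 / \<mu>) (- 0) (- 0) \<mu> (proj_class x)))" for x
  proof -
    define S where "S = (\<lambda>u :: nat \<Rightarrow> complex. \<Sum>i\<le>d. u i * (x 0 ^ i * x 1 ^ (d - i) / k ^ i))"
    have eval_v: "(\<Sum>i\<le>d. u i * (x 0 / \<mu>) ^ i * (\<mu> * x 1) ^ (d - i)) = \<mu> ^ d * S u" for u
      unfolding S_def sum_distrib_left
      by (intro sum.cong) (simp_all only: mult.assoc pow atMost_iff mult.left_commute)
    have eval_w: "(\<Sum>i\<le>d. w i * x 0 ^ i * x 1 ^ (d - i)) = c * k * S v"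
      "(\<Sum>i\<le>d. w (d + 1 + i) * x 0 ^ i * x 1 ^ (d - i)) = c * S (\<lambda>i. v (d + 1 + i))"
      unfolding S_def sum_distrib_left by (intro sum.cong; simp add: w del: add_Suc add_Suc_right One_nat_def)+
    have "hom_eval d w x = (\<lambda>i. (c * \<mu> / \<mu> ^ d) *
        moebius_vec \<mu> 0 0 (1 / \<mu>) (hom_eval d v (moebius_vec (1 / \<mu>) (- 0) (- 0) \<mu> x)) i)" (is "?l = ?r")
    proof
      fix i :: nat
      consider "i = 0" | "i = 1" | "i > 1" by linarith
      then show "?l i = ?r i"
      proof cases
        case 1
        have "?l i = c * k * S v" using eval_w(1) by (simp add: 1 hom_eval_def)
        also have "\<dots> = c * \<mu> / \<mu> ^ d * (\<mu> * (\<mu> ^ d * S v))"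
          using \<mu> by (simp add: power2_eq_square)
        finally show ?thesis
          using eval_v[of v] by (simp add: 1 moebius_vec_def hom_eval_def)
      next
        case 2
        have "?l i = c * S (\<lambda>i. v (d + 1 + i))" using eval_w(2) by (simp add: 2 hom_eval_def)
        also have "\<dots> = c * \<mu> / \<mu> ^ d * (1 / \<mu> * (\<mu> ^ d * S (\<lambda>i. v (d + 1 + i))))"
          using \<mu> by simp
        finally show ?thesis
          using eval_v[of "\<lambda>i. v (d + 1 + i)"] by (simp add: 2 moebius_vec_def hom_eval_def)
      qed (simp add: moebius_vec_def hom_eval_def)
    qed
    moreover have "c * \<mu> / \<mu> ^ d \<noteq> 0" using \<mu>(2) assms(5) by simp
    ultimately have "proj_class (hom_eval d w x) = proj_class
        (moebius_vec \<mu> 0 0 (1 / \<mu>) (hom_eval d v (moebius_vec (1 / \<mu>) (- 0) (- 0) \<mu> x)))"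
      using proj_class_scale by metis
    then show ?thesis
      by (simp only: moebius_P1_class rat_map_class)
  qed
  then have "equivalent d (proj_class v) (proj_class w)"
    unfolding equivalent_def topspace_proj_space using \<mu>(2)
    by (intro exI[of _ \<mu>] exI[of _ 0] exI[of _ "1 / \<mu>"]) auto
  then have "moduli_point d f = moduli_point d g"
    using orbit_eq_if_equivalent real_map_in_Rat_space assms(1-3)
    unfolding moduli_point_def v_def w_def by blast
  then show ?thesis
    using linked_refl[OF assms(1,3)] unfolding linked_def by simp
qed

section \<open>Deformations of real maps that fix infinity\<close>

definition fixes_infinity :: "nat \<Rightarrow> complex poly \<times> complex poly \<Rightarrow> bool" where
  "fixes_infinity d f \<longleftrightarrow> real_map d f \<and> coeff (snd f) d = 0"

text \<open>
  Homotopy of real maps that fix infinity, up to a real scalar factor. It is generated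
  inductively because a property such as stability under \<open>cont_frac_step\<close> is then checked
  on single paths and on rescalings only.
\<close>

inductive deforms ::
  "nat \<Rightarrow> complex poly \<times> complex poly \<Rightarrow> complex poly \<times> complex poly \<Rightarrow> bool"
  for d :: nat where
  path: "connected S \<Longrightarrow> u \<in> S \<Longrightarrow> v \<in> S \<Longrightarrow>
     (\<And>i. continuous_on S (\<lambda>t :: real. coeff (fst (F t)) i)) \<Longrightarrow>
     (\<And>i. continuous_on S (\<lambda>t. coeff (snd (F t)) i)) \<Longrightarrow>
     (\<And>t. t \<in> S \<Longrightarrow> fixes_infinity d (F t)) \<Longrightarrow> deforms d (F u) (F v)"
| scale: "fixes_infinity d f \<Longrightarrow> c \<in> \<real> \<Longrightarrow> c \<noteq> 0 \<Longrightarrow>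
     deforms d f (smult c (fst f), smult c (snd f))"
| trans: "deforms d f g \<Longrightarrow> deforms d g h \<Longrightarrow> deforms d f h"

lemma fixes_infinityD:
  assumes "fixes_infinity d f"
  shows "coeff (fst f) i \<in> \<real>" "coeff (snd f) i \<in> \<real>" "degree (fst f) = d"
    "coeff (fst f) d \<noteq> 0" "i \<ge> d \<Longrightarrow> coeff (snd f) i = 0" "i > d \<Longrightarrow> coeff (fst f) i = 0"
    "poly (fst f) z \<noteq> 0 \<or> poly (snd f) z \<noteq> 0" "real_map d f"
proof -
  show "degree (fst f) = d" using assms le_degree unfolding fixes_infinity_def real_map_def
    by (auto intro: antisym)
  show "i \<ge> d \<Longrightarrow> coeff (snd f) i = 0" using assms unfolding fixes_infinity_def real_map_def
    by (cases "i = d") (auto intro!: coeff_eq_0)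
qed (use assms in \<open>auto simp: fixes_infinity_def real_map_def intro!: coeff_eq_0\<close>)

lemma fixes_infinityI:
  assumes "\<And>i. coeff (fst f) i \<in> \<real>" "\<And>i. coeff (snd f) i \<in> \<real>"
    "coeff (fst f) d \<noteq> 0" "\<And>i. i \<ge> d \<Longrightarrow> coeff (snd f) i = 0" "\<And>i. i > d \<Longrightarrow> coeff (fst f) i = 0"
    "\<And>z. poly (fst f) z = 0 \<Longrightarrow> poly (snd f) z = 0 \<Longrightarrow> False"
  shows "fixes_infinity d f"
  using assms unfolding fixes_infinity_def real_map_def by (auto intro!: degree_le)

lemma fixes_infinity_scale:
  assumes "fixes_infinity d f" "c \<in> \<real>" "c \<noteq> 0"
  shows "fixes_infinity d (smult c (fst f), smult c (snd f))"
  using assms fixes_infinityD[OF assms(1)] by (intro fixes_infinityI) (auto intro: Reals_mult)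

lemma deforms_fixes_infinity:
  "deforms d f g \<Longrightarrow> fixes_infinity d f \<and> fixes_infinity d g"
  by (induction rule: deforms.induct) (auto intro: fixes_infinity_scale)

lemma deforms_refl: "fixes_infinity d f \<Longrightarrow> deforms d f f"
  using deforms.scale[of d f 1] by simp

lemma deforms_sym: "deforms d f g \<Longrightarrow> deforms d g f"
proof (induction rule: deforms.induct)
  case (path S a b f)
  then show ?case by (intro deforms.path[of S b a f]) auto
next
  case (scale f c)
  then show ?case
    using deforms.scale[OF fixes_infinity_scale[OF scale], of "1 / c"] by (simp add: Reals_divide)
next
  case (trans f g h)
  then show ?case by (blast intro: deforms.trans)
qed

lemma deforms_imp_linked:
  assumes "deforms d f g" "d > 0"
  shows "linked d f g"
  using assms(1)
proof (induction rule: deforms.induct)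
  case (path S a b f)
  then show ?case using assms(2) by (intro linked_path[of d S a b f]) (auto dest: fixes_infinityD(8))
next
  case (scale f c)
  then show ?case
    using assms(2) fixes_infinity_scale[OF scale] fixes_infinityD(8)
    by (intro linked_if_scaling_conjugate[of d _ _ 1 c]) auto
next
  case (trans f g h)
  then show ?case by (blast intro: linked_trans)
qed

text \<open>
  The passage from \<open>f\<close> to \<open>A + 1 / f\<close>.
\<close>

definition cont_frac_step :: "complex poly \<Rightarrow> complex poly \<times> complex poly \<Rightarrow> complex poly \<times> complex poly" where
  "cont_frac_step A f = (A * fst f + snd f, fst f)"

lemma fixes_infinity_step:
  assumes "fixes_infinity d f" "a \<in> \<real>" "b \<in> \<real>" "a \<noteq> 0"
  shows "fixes_infinity (Suc d) (cont_frac_step [:b, a:] f)"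
proof (rule fixes_infinityI)
  note f = fixes_infinityD[OF assms(1)]
  show "coeff (fst (cont_frac_step [:b, a:] f)) i \<in> \<real>" for i
    using assms f by (auto simp: cont_frac_step_def coeff_pCons split: nat.splits intro!: Reals_add Reals_mult)
  show "coeff (snd (cont_frac_step [:b, a:] f)) i \<in> \<real>" for i
    using f by (auto simp: cont_frac_step_def)
  show "coeff (fst (cont_frac_step [:b, a:] f)) (Suc d) \<noteq> 0"
    using assms(4) f by (simp add: cont_frac_step_def)
  show "coeff (snd (cont_frac_step [:b, a:] f)) i = 0" if "Suc d \<le> i" for i
    using that f by (simp add: cont_frac_step_def)
  show "coeff (fst (cont_frac_step [:b, a:] f)) i = 0" if "Suc d < i" for i
    using that f by (cases i) (simp_all add: cont_frac_step_def)
  show False if "poly (fst (cont_frac_step [:b, a:] f)) z = 0" "poly (snd (cont_frac_step [:b, a:] f)) z = 0" for z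
    using that f(7)[of z] by (simp add: cont_frac_step_def)
qed

lemma continuous_on_coeff_mult:
  fixes p q :: "'a :: topological_space \<Rightarrow> complex poly"
  assumes "\<And>i. continuous_on S (\<lambda>t. coeff (p t) i)" "\<And>i. continuous_on S (\<lambda>t. coeff (q t) i)"
  shows "continuous_on S (\<lambda>t. coeff (p t * q t) i)"
  unfolding coeff_mult by (intro continuous_intros assms)

lemma continuous_on_coeff_pCons:
  fixes p :: "'a :: topological_space \<Rightarrow> complex poly"
  assumes "continuous_on S a" "\<And>i. continuous_on S (\<lambda>t. coeff (p t) i)"
  shows "continuous_on S (\<lambda>t. coeff (pCons (a t) (p t)) i)"
  using assms by (cases i) simp_all

lemma deforms_step:
  assumes "deforms d f g" "a \<in> \<real>" "b \<in> \<real>" "a \<noteq> 0"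
  shows "deforms (Suc d) (cont_frac_step [:b, a:] f) (cont_frac_step [:b, a:] g)"
  using assms(1)
proof (induction rule: deforms.induct)
  case (path S u v f)
  show ?case
    by (rule deforms.path[of S u v "\<lambda>t. cont_frac_step [:b, a:] (f t)"])
      (use path assms in \<open>auto simp: cont_frac_step_def intro!: continuous_on_add continuous_on_coeff_mult
        fixes_infinity_step[unfolded cont_frac_step_def] simp del: mult_pCons_left\<close>)
next
  case (scale f c)
  have "cont_frac_step [:b, a:] (smult c (fst f), smult c (snd f)) =
      (smult c (fst (cont_frac_step [:b, a:] f)), smult c (snd (cont_frac_step [:b, a:] f)))"
    by (simp add: cont_frac_step_def smult_add_right mult_smult_right)
  then show ?case
    using deforms.scale[OF fixes_infinity_step[OF scale(1) assms(2-4)] scale(2,3)] by simp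
next
  case (trans f g h)
  then show ?case by (blast intro: deforms.trans)
qed

definition neg_map :: "complex poly \<times> complex poly \<Rightarrow> complex poly \<times> complex poly" where
  "neg_map f = (- fst f, snd f)"

lemma fixes_infinity_neg: "fixes_infinity d f \<Longrightarrow> fixes_infinity d (neg_map f)"
  by (auto simp: fixes_infinity_def real_map_def neg_map_def)

lemma deforms_neg:
  assumes "deforms d f g"
  shows "deforms d (neg_map f) (neg_map g)"
  using assms
proof (induction rule: deforms.induct)
  case (path S u v f)
  then show ?case
    by (intro deforms.path[of S u v "\<lambda>t. neg_map (f t)"])
      (auto simp: fixes_infinity_neg, auto simp: neg_map_def intro!: continuous_intros)
next
  case (scale f c)
  then show ?case
    using deforms.scale[OF fixes_infinity_neg[OF scale(1)] scale(2,3)] by (simp add: neg_map_def)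
next
  case (trans f g h)
  then show ?case by (blast intro: deforms.trans)
qed

text \<open>
  Both ends are images of \<open>f\<close> under matrices of real polynomials with determinant \<open>1\<close>, with
  rows \<open>(x\<^sup>2 + 1, x), (x, 1)\<close> and \<open>(x\<^sup>2 + 1, - x), (- x, 1)\<close>. With \<open>c = cos t\<close> and \<open>s = sin t\<close>, the matrix
  with rows \<open>(x\<^sup>2 + 1, c * x + s), (c * x - s, c\<^sup>2)\<close> has determinant \<open>c\<^sup>2 + s\<^sup>2 = 1\<close> and joins the two;
  the constant determinant is what keeps numerator and denominator coprime along the path.
\<close>

lemma deforms_flip:
  assumes "fixes_infinity d f"
  shows "deforms (Suc (Suc d)) (cont_frac_step [:0, 1:] (cont_frac_step [:0, 1:] f)) (cont_frac_step [:0, -1:] (cont_frac_step [:0, -1:] f))"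
proof -
  define F :: "real \<Rightarrow> complex poly \<times> complex poly" where
    "F t = ([:1, 0, 1:] * fst f + [:of_real (sin t), of_real (cos t):] * snd f,
            [:- of_real (sin t), of_real (cos t):] * fst f + [:of_real ((cos t)\<^sup>2):] * snd f)" for t
  note f = fixes_infinityD[OF assms]
  have "fixes_infinity (Suc (Suc d)) (F t)" for t
  proof (rule fixes_infinityI)
    show "coeff (fst (F t)) i \<in> \<real>" "coeff (snd (F t)) i \<in> \<real>" for i
      using f by (auto simp: F_def coeff_pCons split: nat.splits intro!: Reals_add Reals_mult Reals_diff Reals_power)
    show "coeff (fst (F t)) (Suc (Suc d)) \<noteq> 0"
      using f by (simp add: F_def)
    show "coeff (snd (F t)) i = 0" if "Suc (Suc d) \<le> i" for i
      using that f by (cases i) (simp_all add: F_def)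
    show "coeff (fst (F t)) i = 0" if "Suc (Suc d) < i" for i
    proof -
      define j where "j = i - 2"
      have "i = Suc (Suc j)" "j > d" using that by (auto simp: j_def)
      then show ?thesis using f by (simp add: F_def)
    qed
    show False if "poly (fst (F t)) z = 0" "poly (snd (F t)) z = 0" for z
    proof -
      define c s p q where "c = complex_of_real (cos t)" "s = complex_of_real (sin t)"
        "p = poly (fst f) z" "q = poly (snd f) z"
      have cs: "c\<^sup>2 + s\<^sup>2 = 1"
        unfolding c_s_p_q_def using sin_cos_squared_add2[of t]
        by (metis of_real_1 of_real_add of_real_power)
      have 1: "(z\<^sup>2 + 1) * p + (c * z + s) * q = 0" "(c * z - s) * p + c\<^sup>2 * q = 0"
        using that by (simp_all add: F_def c_s_p_q_def algebra_simps power2_eq_square)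
      \<comment> \<open>Multiplication by the adjugate matrix recovers both values.\<close>
      have "(c\<^sup>2 + s\<^sup>2) * p = c\<^sup>2 * ((z\<^sup>2 + 1) * p + (c * z + s) * q) - (c * z + s) * ((c * z - s) * p + c\<^sup>2 * q)"
        by (simp add: algebra_simps power2_eq_square)
      moreover have "(c\<^sup>2 + s\<^sup>2) * q = (z\<^sup>2 + 1) * ((c * z - s) * p + c\<^sup>2 * q) - (c * z - s) * ((z\<^sup>2 + 1) * p + (c * z + s) * q)"
        by (simp add: algebra_simps power2_eq_square)
      ultimately have "p = 0" "q = 0" unfolding 1 cs by simp_all
      then show False using f(7)[of z] by (simp add: c_s_p_q_def)
    qed
  qed
  moreover have "continuous_on UNIV (\<lambda>t. coeff (fst (F t)) i)" "continuous_on UNIV (\<lambda>t. coeff (snd (F t)) i)" for i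
    unfolding F_def fst_conv snd_conv coeff_add
    by (intro continuous_on_add continuous_on_coeff_mult continuous_on_coeff_pCons continuous_intros)+
  ultimately have "deforms (Suc (Suc d)) (F 0) (F pi)"
    by (intro deforms.path[of UNIV]) auto
  moreover have "F 0 = cont_frac_step [:0, 1:] (cont_frac_step [:0, 1:] f)" "F pi = cont_frac_step [:0, -1:] (cont_frac_step [:0, -1:] f)"
    by (simp_all add: F_def cont_frac_step_def algebra_simps)
  ultimately show ?thesis by simp
qed

text \<open>
  The path adds \<open>t * x ^ d\<close> to the denominator. A common root \<open>z\<close> with the numerator can appear only
  if \<open>t\<close> equals \<open>- snd f (z) / z ^ d\<close> for one of the finitely many roots \<open>z\<close> of the numerator, and
  these values stay away from \<open>0\<close> apart from \<open>0\<close> itself.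
\<close>

lemma deforms_denominator_degree:
  assumes "fixes_infinity (Suc d) f"
  obtains g where "deforms (Suc d) f g" "coeff (snd g) d \<noteq> 0"
proof (cases "coeff (snd f) d = 0")
  case False
  then show thesis using that deforms_refl[OF assms] by blast
next
  case True
  note f = fixes_infinityD[OF assms]
  have low: "coeff (snd f) i = 0" if "i \<ge> d" for i
    using True f(5)[of i] that by (cases "i = d") auto
  have "d > 0"
  proof (rule ccontr)
    assume "\<not> d > 0"
    then have "snd f = 0" using low by (intro poly_eqI) simp
    moreover obtain z where "poly (fst f) z = 0"
      using fundamental_theorem_of_algebra_alt[of "fst f"] f(3) by fastforce
    ultimately show False using f(7)[of z] by simp
  qed
  define B where "B = (\<lambda>z. - poly (snd f) z / z ^ d) ` {z. poly (fst f) z = 0}"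
  have "fst f \<noteq> 0" using f(4) by auto
  then have "finite B" unfolding B_def using poly_roots_finite by blast
  then have "\<exists>\<delta>>0. \<forall>x\<in>B. x \<noteq> 0 \<longrightarrow> \<delta> \<le> cmod x"
  proof (induction rule: finite_induct)
    case empty
    then show ?case by (auto intro: exI[of _ 1])
  next
    case (insert x B)
    then obtain \<delta> where "\<delta> > 0" "\<forall>x\<in>B. x \<noteq> 0 \<longrightarrow> \<delta> \<le> cmod x" by blast
    then show ?case
      by (intro exI[of _ "if x = 0 then \<delta> else min \<delta> (cmod x)"]) auto
  qed
  then obtain \<delta> where \<delta>: "\<delta> > 0" "\<And>x. x \<in> B \<Longrightarrow> x \<noteq> 0 \<Longrightarrow> \<delta> \<le> cmod x" by blast
  define F :: "real \<Rightarrow> complex poly \<times> complex poly" where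
    "F t = (fst f, snd f + monom (of_real t) d)" for t
  have "fixes_infinity (Suc d) (F t)" if t: "t \<in> {0..\<delta>/2}" for t
  proof (rule fixes_infinityI)
    show "coeff (fst (F t)) i \<in> \<real>" "coeff (snd (F t)) i \<in> \<real>" for i
      using f by (auto simp: F_def coeff_monom intro!: Reals_add)
    show "coeff (fst (F t)) (Suc d) \<noteq> 0" "Suc d < i \<Longrightarrow> coeff (fst (F t)) i = 0" for i
      using f by (auto simp: F_def)
    show "coeff (snd (F t)) i = 0" if "Suc d \<le> i" for i
      using that f by (simp add: F_def)
    show False if z: "poly (fst (F t)) z = 0" "poly (snd (F t)) z = 0" for z
    proof -
      have eq: "poly (fst f) z = 0" "poly (snd f) z + of_real t * z ^ d = 0"
        using z by (simp_all add: F_def poly_monom)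
      then have "of_real t * z ^ d \<noteq> 0" using f(7)[of z] by (metis add.right_neutral)
      then have "t \<noteq> 0" "z \<noteq> 0" using \<open>d > 0\<close> by (auto simp: zero_power)
      then have "of_real t = - poly (snd f) z / z ^ d"
        using eq(2) by (simp add: field_simps add_eq_0_iff)
      then have "complex_of_real t \<in> B" unfolding B_def using eq(1) by blast
      then have "\<delta> \<le> cmod (of_real t)" using \<delta>(2)[of "of_real t"] \<open>t \<noteq> 0\<close> by simp
      then show False using t \<delta>(1) by simp
    qed
  qed
  moreover have "continuous_on {0..\<delta>/2} (\<lambda>t. coeff (fst (F t)) i)"
    "continuous_on {0..\<delta>/2} (\<lambda>t. coeff (snd (F t)) i)" for i
    unfolding F_def fst_conv snd_conv coeff_add coeff_monom by (cases "i = d"; auto intro!: continuous_intros)+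
  ultimately have "deforms (Suc d) (F 0) (F (\<delta>/2))"
    using \<delta>(1) by (intro deforms.path[of "{0..\<delta>/2}"]) auto
  moreover have "F 0 = f" by (simp add: F_def)
  moreover have "coeff (snd (F (\<delta>/2))) d \<noteq> 0" using True \<delta>(1) by (simp add: F_def)
  ultimately show thesis using that by metis
qed

text \<open>
  One step of the Euclidean algorithm writes \<open>f\<close> as \<open>\<alpha> * x + \<beta> + 1 / h\<close> with real \<open>\<alpha> \<noteq> 0\<close>. With \<open>h\<close> kept
  fixed, \<open>\<beta>\<close> can be moved to \<open>0\<close> and \<open>\<alpha>\<close> to its sign.
\<close>

lemma deforms_division:
  assumes "fixes_infinity (Suc d) f" "coeff (snd f) d \<noteq> 0"
  obtains s h where "s \<in> {1, -1}" "fixes_infinity d h" "deforms (Suc d) f (cont_frac_step [:0, s:] h)"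
proof -
  note f = fixes_infinityD[OF assms(1)]
  define \<alpha> where "\<alpha> = coeff (fst f) (Suc d) / coeff (snd f) d"
  define \<beta> where "\<beta> = coeff (fst f - pCons 0 (smult \<alpha> (snd f))) d / coeff (snd f) d"
  define h where "h = (snd f, fst f - [:\<beta>, \<alpha>:] * snd f)"
  have \<alpha>: "\<alpha> \<in> \<real>" "\<alpha> \<noteq> 0" using f assms(2) by (auto simp: \<alpha>_def intro: Reals_divide)
  have \<beta>: "\<beta> \<in> \<real>" using f \<alpha>
    by (auto simp: \<beta>_def coeff_pCons split: nat.splits intro!: Reals_divide Reals_diff Reals_mult)
  have h: "fixes_infinity d h"
  proof (rule fixes_infinityI)
    show "coeff (fst h) i \<in> \<real>" "coeff (snd h) i \<in> \<real>" for i
      using f \<alpha> \<beta> by (auto simp: h_def coeff_pCons split: nat.splits intro!: Reals_diff Reals_add Reals_mult)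
    show "coeff (fst h) d \<noteq> 0" using assms(2) by (simp add: h_def)
    show "coeff (fst h) i = 0" if "d < i" for i using that f by (simp add: h_def)
    show "coeff (snd h) i = 0" if i: "d \<le> i" for i
    proof -
      consider "i = d" | "i = Suc d" | "i > Suc d" using i by linarith
      then show ?thesis
      proof cases
        case 1
        have "\<beta> * coeff (snd f) d = coeff (fst f) d - coeff (pCons 0 (smult \<alpha> (snd f))) d"
          using assms(2) by (simp add: \<beta>_def)
        then show ?thesis by (simp add: 1 h_def)
      next
        case 2
        then show ?thesis using f(5)[of "Suc d"] assms(2) by (simp add: h_def \<alpha>_def)
      next
        case 3
        then obtain j where "i = Suc j" "j \<ge> Suc d" by (cases i) auto
        then show ?thesis using f(5,6) by (simp add: h_def)
      qed
    qed
    show False if "poly (fst h) z = 0" "poly (snd h) z = 0" for z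
      using that f(7)[of z] by (simp add: h_def)
  qed
  obtain a where a: "\<alpha> = of_real a" using \<alpha>(1) by (auto elim: Reals_cases)
  obtain b where b: "\<beta> = of_real b" using \<beta> by (auto elim: Reals_cases)
  define F :: "real \<Rightarrow> complex poly \<times> complex poly" where
    "F t = cont_frac_step [:of_real ((1 - t) * b), of_real ((1 - t) * a + t * sgn a):] h" for t
  have nz: "(1 - t) * a + t * sgn a \<noteq> 0" if "t \<in> {0..1}" for t :: real
  proof -
    have "a \<noteq> 0" using \<alpha>(2) a by simp
    have "a = sgn a * \<bar>a\<bar>" by (simp add: sgn_mult_abs)
    then have "(1 - t) * a + t * sgn a = sgn a * ((1 - t) * \<bar>a\<bar> + t)"
      by (metis (no_types, opaque_lifting) distrib_left mult.commute mult.left_commute)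
    moreover have "(1 - t) * \<bar>a\<bar> + t > 0"
      using that \<open>a \<noteq> 0\<close> by (cases "t = 0") (auto intro: add_nonneg_pos)
    ultimately show ?thesis using \<open>a \<noteq> 0\<close> by (simp add: sgn_eq_0_iff)
  qed
  have "fixes_infinity (Suc d) (F t)" if "t \<in> {0..1}" for t
    unfolding F_def using nz[OF that] h by (intro fixes_infinity_step) (simp_all only: Reals_of_real of_real_eq_0_iff not_False_eq_True)
  moreover have "continuous_on {0..1} (\<lambda>t. coeff (fst (F t)) i)"
    "continuous_on {0..1} (\<lambda>t. coeff (snd (F t)) i)" for i
    unfolding F_def cont_frac_step_def fst_conv snd_conv coeff_add
    by (intro continuous_on_add continuous_on_coeff_mult continuous_on_coeff_pCons continuous_intros)+
  ultimately have "deforms (Suc d) (F 0) (F 1)"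
    by (intro deforms.path[of "{0..1}"]) auto
  moreover have "F 0 = f"
    by (simp add: F_def cont_frac_step_def h_def prod_eq_iff flip: a b del: mult_pCons_left)
  moreover have "F 1 = cont_frac_step [:0, of_real (sgn a):] h"
    by (simp add: F_def)
  moreover have "complex_of_real (sgn a) \<in> {1, -1}"
    using \<alpha>(2) a by (auto simp: sgn_if)
  ultimately show thesis using that h by metis
qed

section \<open>Continued fractions with signs\<close>

text \<open>
  \<open>cont_frac [a\<^sub>1, \<dots>, a\<^sub>n]\<close> is \<open>a\<^sub>1 * x + 1 / (a\<^sub>2 * x + 1 / (\<dots> + 1 / (a\<^sub>n * x)))\<close>. The empty word gives the
  constant map to infinity, so that \<open>1\<close> over it vanishes in the innermost step.
\<close>

fun cont_frac :: "complex list \<Rightarrow> complex poly \<times> complex poly" where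
  "cont_frac [] = (1, 0)"
| "cont_frac (a # w) = cont_frac_step [:0, a:] (cont_frac w)"

abbreviation "sign_word w \<equiv> set w \<subseteq> {1, -1 :: complex}"

lemma fixes_infinity_cont_frac: "sign_word w \<Longrightarrow> fixes_infinity (length w) (cont_frac w)"
proof (induction w)
  case Nil
  then show ?case by (auto intro!: fixes_infinityI simp: coeff_1)
next
  case (Cons a w)
  then show ?case by (auto intro!: fixes_infinity_step)
qed

text \<open>
  The Euclidean algorithm, run along paths. The perturbation of the denominator makes every
  partial quotient linear.
\<close>

lemma deforms_to_cont_frac:
  assumes "fixes_infinity d f"
  shows "\<exists>w. length w = d \<and> sign_word w \<and> deforms d f (cont_frac w)"
  using assms
proof (induction d arbitrary: f)
  case 0
  note f = fixes_infinityD[OF 0]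
  have "snd f = 0" using f(5) by (intro poly_eqI) simp
  moreover have c: "coeff (fst f) 0 \<in> \<real>" "coeff (fst f) 0 \<noteq> 0" using f by auto
  moreover have "fst f = [:coeff (fst f) 0:]" using f(3) by (metis degree_0_id)
  ultimately have "(smult (1 / coeff (fst f) 0) (fst f), smult (1 / coeff (fst f) 0) (snd f)) = cont_frac []"
    by (metis (no_types, lifting) cont_frac.simps(1) mult_1 nonzero_eq_divide_eq one_pCons smult_0_right smult_pCons times_divide_eq_left)
  then have "deforms 0 f (cont_frac [])"
    using deforms.scale[OF 0, of "1 / coeff (fst f) 0"] c by (simp add: Reals_divide)
  then show ?case by (intro exI[of _ "[]"]) simp
next
  case (Suc d)
  \<comment> \<open>Before the division the denominator is moved to degree exactly one less than the numerator.\<close>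
  obtain g where g: "deforms (Suc d) f g" "coeff (snd g) d \<noteq> 0"
    using deforms_denominator_degree[OF Suc.prems] by blast
  then obtain s h where h: "s \<in> {1, -1}" "fixes_infinity d h" "deforms (Suc d) g (cont_frac_step [:0, s:] h)"
    using deforms_division deforms_fixes_infinity by blast
  obtain w where w: "length w = d" "sign_word w" "deforms d h (cont_frac w)"
    using Suc.IH[OF h(2)] by blast
  have "deforms (Suc d) (cont_frac_step [:0, s:] h) (cont_frac_step [:0, s:] (cont_frac w))"
    using w(3) h(1) by (intro deforms_step) auto
  then have "deforms (Suc d) f (cont_frac (s # w))"
    using g(1) h(3) by (auto intro: deforms.trans)
  then show ?case using w(1,2) h(1) by (intro exI[of _ "s # w"]) auto
qed

lemma deforms_flip_adjacent:
  assumes "sign_word u" "sign_word v" "a \<in> {1, -1}"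
  shows "deforms (length u + (2 + length v)) (cont_frac (u @ [a, a] @ v)) (cont_frac (u @ [- a, - a] @ v))"
  using assms(1)
proof (induction u)
  case Nil
  have "deforms (Suc (Suc (length v))) (cont_frac ([1, 1] @ v)) (cont_frac ([-1, -1] @ v))"
    using deforms_flip[OF fixes_infinity_cont_frac[OF assms(2)]] by simp
  from this deforms_sym[OF this] show ?case using assms(3) by auto
next
  case (Cons b u)
  then have "deforms (length u + (2 + length v)) (cont_frac (u @ [a, a] @ v)) (cont_frac (u @ [- a, - a] @ v))"
    by simp
  from deforms_step[OF this, of b 0] Cons.prems show ?case by auto
qed

section \<open>Changing signs by conjugation over the complex numbers\<close>

fun alternate :: "complex \<Rightarrow> complex list \<Rightarrow> complex list" where
  "alternate s [] = []"
| "alternate s (a # w) = s * a # alternate (- s) w"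

lemma length_alternate [simp]: "length (alternate s w) = length w"
  by (induction s w rule: alternate.induct) auto

lemma sign_word_alternate: "s \<in> {1, -1} \<Longrightarrow> sign_word w \<Longrightarrow> sign_word (alternate s w)"
  by (induction s w rule: alternate.induct) auto

lemma alternate_append: "alternate s (u @ v) = alternate s u @ alternate (s * (- 1) ^ length u) v"
  by (induction s u rule: alternate.induct) auto

text \<open>
  A continued fraction with partial quotients \<open>a\<^sub>i * x\<close> is an odd function, so its conjugate by
  \<open>x \<mapsto> \<i> * x\<close> is again real; the conjugation multiplies every second sign by \<open>- 1\<close>. The version with
  a free sign \<open>s\<close> makes the induction work: the tail of an alternating word alternates from \<open>- s\<close>.
\<close>

lemma cont_frac_alternate:
  assumes "s \<in> {1, -1}"
  shows "\<exists>c. c \<noteq> 0 \<and>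
    fst (cont_frac (alternate s w)) = smult (c * s * \<i>) (fst (cont_frac w) \<circ>\<^sub>p [:0, - \<i>:]) \<and>
    snd (cont_frac (alternate s w)) = smult c (snd (cont_frac w) \<circ>\<^sub>p [:0, - \<i>:])"
  using assms
proof (induction w arbitrary: s)
  case Nil
  then show ?case by (intro exI[of _ "- s * \<i>"]) (auto simp: pcompose_1)
next
  case (Cons a w)
  have s: "- s \<in> {1, -1}" "s * s = 1" "s \<noteq> 0" using Cons.prems by auto
  obtain c where c: "c \<noteq> 0"
    "fst (cont_frac (alternate (- s) w)) = smult (c * - s * \<i>) (fst (cont_frac w) \<circ>\<^sub>p [:0, - \<i>:])"
    "snd (cont_frac (alternate (- s) w)) = smult c (snd (cont_frac w) \<circ>\<^sub>p [:0, - \<i>:])"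
    using Cons.IH[OF s(1)] by blast
  have "fst (cont_frac (alternate s (a # w))) = smult (- \<i> * s * c * s * \<i>) (fst (cont_frac (a # w)) \<circ>\<^sub>p [:0, - \<i>:])"
    using s(2) by (simp add: cont_frac_step_def c(2,3) pcompose_add pcompose_mult pcompose_pCons pcompose_smult smult_add_right algebra_simps)
  moreover have "snd (cont_frac (alternate s (a # w))) = smult (- \<i> * s * c) (snd (cont_frac (a # w)) \<circ>\<^sub>p [:0, - \<i>:])"
    by (simp add: cont_frac_step_def c(2) mult_ac)
  ultimately show ?case using c(1) s(3) by (intro exI[of _ "- \<i> * s * c"]) auto
qed

lemma linked_alternate:
  assumes "sign_word w" "w \<noteq> []"
  shows "linked (length w) (cont_frac w) (cont_frac (alternate 1 w))"
proof -
  obtain c where c: "c \<noteq> 0"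
    "fst (cont_frac (alternate 1 w)) = smult (c * \<i>) (fst (cont_frac w) \<circ>\<^sub>p [:0, - \<i>:])"
    "snd (cont_frac (alternate 1 w)) = smult c (snd (cont_frac w) \<circ>\<^sub>p [:0, - \<i>:])"
    using cont_frac_alternate[of 1 w] by auto
  have "real_map (length w) (cont_frac w)" "real_map (length w) (cont_frac (alternate 1 w))"
    using fixes_infinity_cont_frac[of w] fixes_infinity_cont_frac[of "alternate 1 w"] sign_word_alternate[of 1 w] assms(1)
      fixes_infinityD(8) by auto
  moreover have "(- \<i>) ^ n = 1 / \<i> ^ n" for n
    by (simp add: power_one_over[symmetric])
  ultimately show ?thesis
    using assms(2) c(1) by (intro linked_if_scaling_conjugate[of _ _ _ \<i> c]) (simp_all add: c(2,3) coeff_pcompose_linear)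
qed

text \<open>
  Two equal adjacent signs can be negated by a deformation of real maps. Two opposite ones become
  equal under conjugation by \<open>x \<mapsto> \<i> * x\<close>, are negated there, and are conjugated back.
\<close>

lemma linked_flip_adjacent:
  assumes "sign_word (u @ [a, b] @ v)"
  shows "linked (length (u @ [a, b] @ v)) (cont_frac (u @ [a, b] @ v)) (cont_frac (u @ [- a, - b] @ v))"
proof (cases "a = b")
  case True
  then show ?thesis
    using deforms_imp_linked[OF deforms_flip_adjacent[of u v a]] assms by simp
next
  case False
  then have b: "b = - a" and a: "a \<in> {1, -1}" using assms by auto
  define s where "s = (- 1 :: complex) ^ length u"
  have s: "s \<in> {1, -1}" unfolding s_def by (cases "even (length u)") auto
  define u' v' where "u' = alternate 1 u" "v' = alternate s v"
  have alt: "alternate 1 (u @ [c, - c] @ v) = u' @ [s * c, s * c] @ v'" for c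
    unfolding alternate_append by (simp add: u'_v'_def s_def)
  have words: "sign_word (u @ [c, - c] @ v)" if "c \<in> {a, - a}" for c
    using assms a that by auto
  have "sign_word u'" "sign_word v'"
    using assms s sign_word_alternate[of 1 u] sign_word_alternate[of s v] by (auto simp: u'_v'_def)
  then have "linked (length u + (2 + length v)) (cont_frac (u' @ [s * a, s * a] @ v')) (cont_frac (u' @ [- (s * a), - (s * a)] @ v'))"
    using deforms_imp_linked[OF deforms_flip_adjacent[of u' v' "s * a"]] a s by (auto simp: u'_v'_def)
  then have "linked (length u + (2 + length v)) (cont_frac (alternate 1 (u @ [a, - a] @ v))) (cont_frac (alternate 1 (u @ [- a, - (- a)] @ v)))"
    unfolding alt by simp
  moreover have "linked (length u + (2 + length v)) (cont_frac (u @ [c, - c] @ v)) (cont_frac (alternate 1 (u @ [c, - c] @ v)))"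
    if "c \<in> {a, - a}" for c
    using linked_alternate[OF words[OF that]] by simp
  ultimately have "linked (length u + (2 + length v)) (cont_frac (u @ [a, - a] @ v)) (cont_frac (u @ [- a, - (- a)] @ v))"
    by (meson insertI1 insertI2 linked_sym linked_trans)
  then show ?thesis by (simp add: b)
qed

text \<open>
  Negating adjacent pairs pushes all minus signs to the last letter, so only the product of the
  signs remains. The prefix \<open>u\<close> collects the letters that are already \<open>1\<close>.
\<close>

lemma linked_to_last_sign:
  assumes "sign_word (u @ w)" "w \<noteq> []"
  shows "linked (length (u @ w)) (cont_frac (u @ w)) (cont_frac (u @ replicate (length w - 1) 1 @ [prod_list w]))"
  using assms
proof (induction "length w" arbitrary: u w)
  case 0
  then show ?case by simp
next
  case (Suc n)
  have refl: "linked (length (u @ w)) (cont_frac (u @ w)) (cont_frac (u @ w))"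
    using linked_refl[OF fixes_infinityD(8)[OF fixes_infinity_cont_frac[OF Suc.prems(1)]]] Suc.prems(2) by simp
  show ?case
  \<comment> \<open>The cases are the words of length zero, of length one, and of length at least two.\<close>
  proof (cases w rule: remdups_adj.cases)
    case 1
    then show ?thesis using Suc.prems by simp
  next
    case (2 a)
    then show ?thesis using refl by simp
  next
    case (3 a b v)
    have signs: "a \<in> {1, -1}" "sign_word (u @ [1] @ a * b # v)"
      using Suc.prems 3 by auto
    have len: "n = length (a * b # v)" using Suc.hyps(2) 3 by simp
    \<comment> \<open>For \<open>a = - 1\<close> the first two letters are negated; in both cases they become \<open>1\<close> and \<open>a * b\<close>.\<close>
    have "linked (length (u @ w)) (cont_frac (u @ w)) (cont_frac ((u @ [1]) @ a * b # v))"
      using signs(1) refl linked_flip_adjacent[of u a b v] Suc.prems(1) 3 by auto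
    moreover have "linked (length ((u @ [1]) @ a * b # v)) (cont_frac ((u @ [1]) @ a * b # v))
        (cont_frac ((u @ [1]) @ replicate (length (a * b # v) - 1) 1 @ [prod_list (a * b # v)]))"
      by (rule Suc.hyps(1)) (use len signs(2) in auto)
    ultimately show ?thesis
      using linked_trans by (auto simp: 3 mult.assoc)
  qed
qed

lemma cont_frac_uminus:
  "fst (cont_frac (map uminus w)) = smult ((-1) ^ length w) (fst (cont_frac w))"
  "snd (cont_frac (map uminus w)) = smult (- ((-1) ^ length w)) (snd (cont_frac w))"
  by (induction w) (simp_all add: cont_frac_step_def smult_add_right)

lemma deforms_neg_cont_frac:
  assumes "sign_word w"
  shows "deforms (length w) (neg_map (cont_frac w)) (cont_frac (map uminus w))"
proof -
  define c :: complex where "c = - ((- 1) ^ length w)"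
  have "c \<in> \<real>" "c \<noteq> 0" by (auto simp: c_def)
  then have "deforms (length w) (neg_map (cont_frac w)) (smult c (fst (neg_map (cont_frac w))), smult c (snd (neg_map (cont_frac w))))"
    by (intro deforms.scale fixes_infinity_neg fixes_infinity_cont_frac assms)
  moreover have "(smult c (fst (neg_map (cont_frac w))), smult c (snd (neg_map (cont_frac w)))) = cont_frac (map uminus w)"
    by (simp add: prod_eq_iff cont_frac_uminus c_def neg_map_def)
  ultimately show ?thesis by simp
qed

lemma prod_list_uminus: "prod_list (map uminus w) = (-1) ^ length w * prod_list w"
  for w :: "'a :: comm_ring_1 list"
  by (induction w) auto

lemma fixes_infinity_monom: "d > 0 \<Longrightarrow> fixes_infinity d (monom 1 d, 1)"
  by (auto intro!: fixes_infinityI simp: coeff_monom coeff_1)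

lemma root_of_minus_one:
  assumes "n > 0"
  obtains k :: complex where "k ^ n = -1"
  using that[of "cis (pi / real n)"] assms by (simp add: DeMoivre)

text \<open>
  Among odd lengths, negating all signs changes the product, and on maps it is \<open>f \<mapsto> - f\<close>. For odd
  \<open>d\<close> the maps \<open>x ^ d\<close> and \<open>- x ^ d\<close> are conjugate by \<open>x \<mapsto> k * x\<close> with \<open>k ^ (d - 1) = - 1\<close>. For even \<open>d\<close>
  the maps \<open>x + 1 / x ^ (d - 1)\<close> and \<open>x - 1 / x ^ (d - 1)\<close> are conjugate with \<open>k ^ d = - 1\<close>, and they are
  obtained by one continued fraction step from \<open>x ^ (d - 1)\<close> and \<open>- x ^ (d - 1)\<close>. It does not matter
  which word the power map deforms to, because its negative deforms to the negated word.
\<close>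

lemma linked_opposite_parity:
  assumes "d \<ge> 2"
  obtains u v where "sign_word u" "sign_word v" "length u = d" "length v = d"
    "prod_list u = - prod_list v" "linked d (cont_frac u) (cont_frac v)"
proof (cases "odd d")
  case True
  obtain w where w: "length w = d" "sign_word w" "deforms d (monom 1 d, 1) (cont_frac w)"
    using deforms_to_cont_frac[OF fixes_infinity_monom, of d] assms by auto
  then have "deforms d (neg_map (monom 1 d, 1)) (cont_frac (map uminus w))"
    using deforms_neg[OF w(3)] deforms_neg_cont_frac[OF w(2)] by (auto intro: deforms.trans)
  obtain k :: complex where k: "k ^ (d - 1) = -1" using root_of_minus_one[of "d - 1"] assms by auto
  then have "k \<noteq> 0" using assms by (auto simp: zero_power)
  have kd: "k ^ d = - k" using k assms by (cases d) auto
  have "linked d (monom 1 d, 1) (neg_map (monom 1 d, 1))"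
  proof (rule linked_if_scaling_conjugate[of d _ _ k 1])
    show "real_map d (monom 1 d, 1)" "real_map d (neg_map (monom 1 d, 1))"
      using fixes_infinity_monom[of d] fixes_infinity_neg fixes_infinityD(8) assms by auto
  qed (use assms \<open>k \<noteq> 0\<close> kd in \<open>auto simp: neg_map_def coeff_monom coeff_1\<close>)
  then have "linked d (cont_frac w) (cont_frac (map uminus w))"
    using deforms_imp_linked[OF w(3)] \<open>deforms d (neg_map _) _\<close>[THEN deforms_imp_linked] assms
    by (meson linked_sym linked_trans pos2 less_le_trans)
  then show thesis
    using w True by (intro that[of w "map uminus w"]) (auto simp: prod_list_uminus)
next
  case False
  define m where "m = d - 1"
  have m: "d = Suc m" "m > 0" "odd m" using assms False by (auto simp: m_def)
  let ?h = "(monom 1 m, 1) :: complex poly \<times> complex poly"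
  obtain w where w: "length w = m" "sign_word w" "deforms m ?h (cont_frac w)"
    using deforms_to_cont_frac[OF fixes_infinity_monom] m(2) by blast
  have neg: "deforms m (neg_map ?h) (cont_frac (map uminus w))"
    using deforms_neg[OF w(3)] deforms_neg_cont_frac[OF w(2)] w(1) by (auto intro: deforms.trans)
  have steps: "deforms d (cont_frac_step [:0, 1:] ?h) (cont_frac (1 # w))"
    "deforms d (cont_frac_step [:0, 1:] (neg_map ?h)) (cont_frac (1 # map uminus w))"
    using deforms_step[OF w(3), of 1 0] deforms_step[OF neg, of 1 0] m(1) by auto
  obtain k :: complex where k: "k ^ d = -1" using root_of_minus_one[of d] m(1) by auto
  then have "k \<noteq> 0" using m(1) by (auto simp: zero_power)
  have km: "k * k ^ m = -1" using k m(1) by simp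
  have "linked d (cont_frac_step [:0, 1:] ?h) (cont_frac_step [:0, 1:] (neg_map ?h))"
  proof (rule linked_if_scaling_conjugate[of d _ _ k "1 / k"])
    show "real_map d (cont_frac_step [:0, 1:] ?h)" "real_map d (cont_frac_step [:0, 1:] (neg_map ?h))"
      using steps deforms_fixes_infinity fixes_infinityD(8) by blast+
    show "coeff (fst (cont_frac_step [:0, 1:] (neg_map ?h))) i =
        1 / k * k * coeff (fst (cont_frac_step [:0, 1:] ?h)) i / k ^ i" for i
      using \<open>k \<noteq> 0\<close> km m
      by (cases i) (auto simp: cont_frac_step_def neg_map_def coeff_monom coeff_1 field_simps)
    show "coeff (snd (cont_frac_step [:0, 1:] (neg_map ?h))) i =
        1 / k * coeff (snd (cont_frac_step [:0, 1:] ?h)) i / k ^ i" for i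
      using \<open>k \<noteq> 0\<close> km by (auto simp: cont_frac_step_def neg_map_def coeff_monom field_simps)
  qed (use \<open>k \<noteq> 0\<close> m(1) in auto)
  then have "linked d (cont_frac (1 # w)) (cont_frac (1 # map uminus w))"
    using steps[THEN deforms_imp_linked] m(1) by (meson linked_sym linked_trans zero_less_Suc)
  then show thesis
    using w m by (intro that[of "1 # w" "1 # map uminus w"]) (auto simp: prod_list_uminus)
qed

lemma linked_cont_frac_all:
  assumes "d \<ge> 2" "sign_word u" "sign_word v" "length u = d" "length v = d"
  shows "linked d (cont_frac u) (cont_frac v)"
proof -
  define N where "N s = cont_frac (replicate (d - 1) 1 @ [s])" for s :: complex
  have to_N: "linked d (cont_frac w) (N (prod_list w))" if "sign_word w" "length w = d" for w
    using linked_to_last_sign[of "[]" w] that assms(1) by (cases w) (auto simp: N_def)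
  obtain p q where pq: "sign_word p" "sign_word q" "length p = d" "length q = d"
    "prod_list p = - prod_list q" "linked d (cont_frac p) (cont_frac q)"
    using linked_opposite_parity[OF assms(1)] by blast
  have sign: "prod_list w \<in> {1, -1}" if "sign_word w" for w :: "complex list"
    using that by (induction w) auto
  have swap: "linked d (N (prod_list p)) (N (- prod_list p))"
    using to_N[OF pq(1,3)] to_N[OF pq(2,4)] pq(5,6) by (metis linked_sym linked_trans minus_minus)
  have "linked d (N (prod_list u)) (N (prod_list v))"
  proof (cases "prod_list u = prod_list v")
    case True
    then show ?thesis using to_N[OF assms(2,4)] by (metis linked_sym linked_trans)
  next
    case False
    then have "prod_list u = prod_list p \<and> prod_list v = - prod_list p \<or>
        prod_list u = - prod_list p \<and> prod_list v = prod_list p"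
      using sign[OF assms(2)] sign[OF assms(3)] sign[OF pq(1)] by auto
    then show ?thesis using swap linked_sym[OF swap] by auto
  qed
  from linked_trans[OF to_N[OF assms(2,4)] linked_trans[OF this linked_sym[OF to_N[OF assms(3,5)]]]]
  show ?thesis .
qed

section \<open>Connectedness of the real locus\<close>

text \<open>
  Composition on the left with a rotation of the real projective line moves the value at infinity
  to infinity, and rotations are joined to the identity. A conjugation alone would not do, since a
  real map can fail to have a real fixed point.
\<close>

lemma linked_to_fixes_infinity:
  assumes "real_map d f" "d > 0"
  obtains g where "fixes_infinity d g" "linked d f g"
proof -
  have "coeff (fst f) d \<in> \<real>" "coeff (snd f) d \<in> \<real>" using assms(1) by (auto simp: real_map_def)
  then obtain p q where p: "coeff (fst f) d = of_real p" and q: "coeff (snd f) d = of_real q"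
    by (auto elim!: Reals_cases)
  obtain r \<theta> where \<theta>: "p = r * cos \<theta>" "q = r * sin \<theta>"
    using polar_Ex by blast
  define F :: "real \<Rightarrow> complex poly \<times> complex poly" where
    "F t = (smult (of_real (cos t)) (fst f) + smult (of_real (sin t)) (snd f),
            smult (- of_real (sin t)) (fst f) + smult (of_real (cos t)) (snd f))" for t
  have cancel: "x = 0 \<and> y = 0" if "of_real (cos t) * x + of_real (sin t) * y = 0"
    "- of_real (sin t) * x + of_real (cos t) * y = 0" for x y :: complex and t
  proof -
    define c s where "c = complex_of_real (cos t)" "s = complex_of_real (sin t)"
    \<comment> \<open>A rotation matrix is inverted by its transpose.\<close>
    have "c * c + s * s = 1"
      unfolding c_s_def using sin_cos_squared_add3[of t] by (metis of_real_1 of_real_add of_real_mult)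
    moreover have "(c * c + s * s) * x = c * (c * x + s * y) - s * (- s * x + c * y)"
      "(c * c + s * s) * y = s * (c * x + s * y) + c * (- s * x + c * y)"
      by (simp_all add: algebra_simps)
    ultimately show ?thesis using that unfolding c_s_def[symmetric] by simp
  qed
  have real: "real_map d (F t)" for t
    unfolding real_map_def
  proof (intro conjI allI)
    show "coeff (fst (F t)) i \<in> \<real>" "coeff (snd (F t)) i \<in> \<real>" for i
      using assms(1) by (auto simp: F_def real_map_def intro!: Reals_add Reals_diff Reals_mult)
    show "degree (fst (F t)) \<le> d" "degree (snd (F t)) \<le> d"
      using assms(1) by (auto simp: F_def real_map_def intro!: degree_add_le degree_diff_le order_trans[OF degree_smult_le])
    show "coeff (fst (F t)) d \<noteq> 0 \<or> coeff (snd (F t)) d \<noteq> 0"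
      using assms(1) cancel[of t "coeff (fst f) d" "coeff (snd f) d"] by (auto simp: F_def real_map_def)
    show "poly (fst (F t)) z \<noteq> 0 \<or> poly (snd (F t)) z \<noteq> 0" for z
      using assms(1) cancel[of t "poly (fst f) z" "poly (snd f) z"] by (auto simp: F_def real_map_def)
  qed
  have "linked d (F 0) (F \<theta>)"
    using assms(2) real
    by (intro linked_path[of d UNIV]) (auto simp: F_def intro!: continuous_intros)
  moreover have "F 0 = f" by (simp add: F_def)
  moreover have "fixes_infinity d (F \<theta>)"
    using real[of \<theta>] by (simp add: fixes_infinity_def F_def p q \<theta>)
  ultimately show thesis using that by metis
qed

theorem lemma3:
  fixes d :: nat
  assumes "d \<ge> 2"
  shows "connectedin (moduli_space d) (real_locus d)"
proof -
  have d: "d > 0" using assms by simp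
  let ?base = "cont_frac (replicate d 1)"
  have base: "linked d f ?base" if f: "real_map d f" for f
  proof -
    obtain g where g: "fixes_infinity d g" "linked d f g"
      using linked_to_fixes_infinity[OF f d] by blast
    obtain w where w: "length w = d" "sign_word w" "deforms d g (cont_frac w)"
      using deforms_to_cont_frac[OF g(1)] by blast
    have "linked d (cont_frac w) ?base"
      using w(1,2) by (intro linked_cont_frac_all[OF assms]) auto
    then show ?thesis
      using g(2) deforms_imp_linked[OF w(3) d] linked_trans by blast
  qed
  define \<T> where "\<T> = {T. connectedin (moduli_space d) T \<and> T \<subseteq> real_locus d \<and> moduli_point d ?base \<in> T}"
  have "real_locus d = \<Union>\<T>"
    using base unfolding real_locus_eq_moduli_points[OF d] linked_def \<T>_def by blast
  moreover have "connectedin (moduli_space d) (\<Union>\<T>)"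
  proof (rule connectedin_Union)
    show "\<Inter>\<T> \<noteq> {}" by (auto simp: \<T>_def)
  qed (simp add: \<T>_def)
  ultimately show ?thesis by simp
qed

end
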